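(* For any constant integer $k\geq 4$, the number of non-convex $k$-holes in any set of $n$ points in general position in the plane is $O(n^{k-1})$ (indeed at most $n!/(n-k+1)!$), and there exist sets of $n$ points in general position with $\Omega(n^{k-1})$ non-convex $k$-holes.
   Context: A point set in the plane is in general position if no three of its points are collinear. For such a point set $S$, a $k$-gon of $S$ is a simple polygon whose vertex set consists of exactly $k$ points of $S$ (distinct simple polygons on the same vertex set count separately), and a $k$-hole is a $k$-gon whose interior contains no point of $S$; it is non-convex if it is not a convex polygon. The constants hidden in the $O$ and $\Omega$ notation may depend on $k$ but not on $n$. *)

theory Defs
  imports "HOL-Analysis.Analysis" "HOL-Library.Landau_Symbols"
begin

text \<open>
  The Euclidean plane is modelled by \<^typ>\<open>complex\<close>, the type for which the library
  develops the Jordan curve theorem; only its real affine and metric structure is used.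
\<close>

definition general_position :: "complex set \<Rightarrow> bool" where
  "general_position S \<longleftrightarrow>
     (\<forall>p\<in>S. \<forall>q\<in>S. \<forall>r\<in>S. p \<noteq> q \<and> p \<noteq> r \<and> q \<noteq> r \<longrightarrow> \<not> collinear {p, q, r})"

text \<open>
  A list \<open>vs\<close> is read cyclically: its \<open>i\<close>-th edge joins \<open>vs ! i\<close> to its cyclic successor.
\<close>

definition edge_ends :: "complex list \<Rightarrow> nat \<Rightarrow> complex set" where
  "edge_ends vs i = {vs ! i, vs ! (Suc i mod length vs)}"

definition edge :: "complex list \<Rightarrow> nat \<Rightarrow> complex set" where
  "edge vs i = closed_segment (vs ! i) (vs ! (Suc i mod length vs))"

definition polygon_boundary :: "complex list \<Rightarrow> complex set" where
  "polygon_boundary vs = (\<Union>i<length vs. edge vs i)"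

text \<open>Simplicity: two different edges meet in their common endpoints only.\<close>

definition simple_polygon :: "complex list \<Rightarrow> bool" where
  "simple_polygon vs \<longleftrightarrow>
     length vs \<ge> 3 \<and> distinct vs \<and>
     (\<forall>i<length vs. \<forall>j<length vs. i \<noteq> j \<longrightarrow>
        edge vs i \<inter> edge vs j = edge_ends vs i \<inter> edge_ends vs j)"

text \<open>
  A polygon is represented by its boundary curve, so the \<open>2k\<close> vertex lists obtained from one
  another by rotation and reversal describe one and the same polygon, whereas different simple
  polygons on the same vertex set are different elements. If \<open>S\<close> is in general position, then
  no vertex is flat, so the boundary curve determines the vertex set and the edges.
  The interior of the polygon with boundary \<open>P\<close> is \<open>inside P\<close>, the union of the bounded components
  of the complement of \<open>P\<close>.
\<close>

definition k_gons :: "nat \<Rightarrow> complex set \<Rightarrow> complex set set" where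
  "k_gons k S =
     {polygon_boundary vs | vs. length vs = k \<and> set vs \<subseteq> S \<and> simple_polygon vs}"

definition k_holes :: "nat \<Rightarrow> complex set \<Rightarrow> complex set set" where
  "k_holes k S = {P \<in> k_gons k S. inside P \<inter> S = {}}"

definition convex_polygon :: "complex set \<Rightarrow> bool" where
  "convex_polygon P \<longleftrightarrow> convex (P \<union> inside P)"

definition nonconvex_k_holes :: "nat \<Rightarrow> complex set \<Rightarrow> complex set set" where
  "nonconvex_k_holes k S = {P \<in> k_holes k S. \<not> convex_polygon P}"

end

theory Submission imports Defs begin

text \<open>
  Upper bound: a polygon that is not convex has a reflex vertex \<open>q\<close>, and the hole is recovered
  from the list of its other \<open>k - 1\<close> vertices, read in the direction that has \<open>q\<close> on a fixed
  side of the line through the first and the last of them. Indeed, if two tips \<open>q\<close> and \<open>q'\<close> close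
  the same chain from the same side and both are reflex, then one of them lies inside the polygon
  of the other. Hence there are at most as many such holes as lists of \<open>k - 1\<close> distinct points.

  Lower bound: only a convex corner can be chosen freely among many points, so take \<open>n - 1\<close> points
  on the parabola \<open>y = x\<^sup>2\<close> and the single point \<open>(0, 2)\<close>, which serves as the reflex vertex. The
  abscissae lie in \<open>[-3, -2)\<close>, \<open>(0, 1/2]\<close> and \<open>(2, 3]\<close>; a chord through \<open>a\<close> and \<open>b\<close> meets the axis
  at height \<open>- a * b\<close>, so \<open>(0, 2)\<close> is above every chord from the left to the middle part and below
  every chord from the left to the right part. Each choice of one left, one right and \<open>k - 3\<close>
  middle points then gives a hole with reflex vertex \<open>(0, 2)\<close>.
\<close>

section \<open>Signed area\<close>

text \<open>The interior of a polygon is that of a Jordan curve, with no angles at hand, so "reflex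
  at \<open>q\<close>" is expressed by an open half disc at \<open>q\<close> within the interior.
  Finding such a vertex is therefore a matter of topology: a line of sight from an interior point is
  turned until it is blocked for the first time, and the first boundary point on the blocked segment
  has a half disc on the swept side. That point is a vertex, because the boundary does not continue
  from it back along the line of sight. To compare two tips, write
  \<open>q' - q = a *\<^sub>R (u - q) + b *\<^sub>R (v - q)\<close>. Lying on the same side of the
  line through \<open>u\<close> and \<open>v\<close> means \<open>a + b < 1\<close>, and general
  position makes \<open>a\<close> and \<open>b\<close> nonzero, so only four sign patterns remain.
  Two of them are mirror images, and the other two differ by exchanging the tips. In the lower bound
  all freedom has to come from the \<open>k - 1\<close> vertices other than the reflex one: one
  choice on the left, one on the right and \<open>k - 3\<close> in the middle already give the full
  exponent.\<close>

definition det2 :: "complex \<Rightarrow> complex \<Rightarrow> real" where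
  "det2 x y = Re x * Im y - Im x * Re y"

lemma det2_simps:
  "det2 (x + y) z = det2 x z + det2 y z"
  "det2 z (x + y) = det2 z x + det2 z y"
  "det2 (x - y) z = det2 x z - det2 y z"
  "det2 z (x - y) = det2 z x - det2 z y"
  "det2 (- x) z = - det2 x z"
  "det2 z (- x) = - det2 z x"
  "det2 (c *\<^sub>R x) z = c * det2 x z"
  "det2 z (c *\<^sub>R x) = c * det2 z x"
  "det2 x x = 0"
  "det2 0 x = 0"
  "det2 x 0 = 0"
  by (auto simp: det2_def algebra_simps)

lemma det2_commute: "det2 y x = - det2 x y"
  by (simp add: det2_def)

lemma continuous_on_det2 [continuous_intros]:
  "continuous_on S f \<Longrightarrow> continuous_on S g \<Longrightarrow> continuous_on S (\<lambda>x. det2 (f x) (g x))"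
  unfolding det2_def by (intro continuous_intros)

lemma det2_eq_0_iff:
  assumes "x \<noteq> 0"
  shows "det2 x y = 0 \<longleftrightarrow> (\<exists>c. y = c *\<^sub>R x)"
proof
  assume d: "det2 x y = 0"
  have n: "(Re x)^2 + (Im x)^2 \<noteq> 0"
    using assms by (simp add: complex_eq_iff)
  \<comment> \<open>The coefficient of the orthogonal projection of \<open>y\<close> onto
    \<open>x\<close>, the only candidate.\<close>
  define c where "c = (Re x * Re y + Im x * Im y) / ((Re x)^2 + (Im x)^2)"
  have "Re y * ((Re x)^2 + (Im x)^2) = (Re x * Re y + Im x * Im y) * Re x"
    using d unfolding det2_def by algebra
  moreover have "Im y * ((Re x)^2 + (Im x)^2) = (Re x * Re y + Im x * Im y) * Im x"
    using d unfolding det2_def by algebra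
  ultimately have "Re y = c * Re x" "Im y = c * Im x"
    using n by (auto simp: c_def field_simps)
  then show "\<exists>c. y = c *\<^sub>R x"
    by (auto simp: complex_eq_iff)
next
  show "\<exists>c. y = c *\<^sub>R x \<Longrightarrow> det2 x y = 0"
    by (auto simp: det2_simps)
qed

lemma collinear_iff_det2: "collinear {p, q, r} \<longleftrightarrow> det2 (q - p) (r - p) = 0"
proof -
  have "collinear {p, q, r} \<longleftrightarrow> collinear {q, p, r}"
    by (simp add: insert_commute)
  also have "\<dots> \<longleftrightarrow> collinear {0, q - p, r - p}"
    using collinear_3[of q p r] by (simp add: NO_MATCH_def)
  also have "\<dots> \<longleftrightarrow> det2 (q - p) (r - p) = 0"
    using det2_eq_0_iff[of "q - p" "r - p"]
    by (cases "q - p = 0"; cases "r - p = 0") (simp_all add: collinear_lemma det2_simps(9-11))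
  finally show ?thesis .
qed

text \<open>Cramer's rule. It turns later questions about the position of a point relative to a tip
  and its two neighbours into the signs of two coefficients.\<close>

lemma det2_coordinates:
  assumes "det2 x y \<noteq> 0"
  shows "z = (det2 z y / det2 x y) *\<^sub>R x + (det2 x z / det2 x y) *\<^sub>R y"
proof -
  have "Re z * det2 x y = det2 z y * Re x + det2 x z * Re y"
       "Im z * det2 x y = det2 z y * Im x + det2 x z * Im y"
    by (auto simp: det2_def algebra_simps)
  then show ?thesis
    using assms by (simp add: complex_eq_iff field_simps)
qed

section \<open>Boundary points of a nonconvex region\<close>

text \<open>A compact segment in \<open>U\<close> has a tube of uniform radius \<open>e\<close>
  within \<open>U\<close>, and moving one endpoint by less than \<open>e\<close> moves every point
  of the segment by less than \<open>e\<close>.\<close>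

lemma star_open:
  fixes U :: "'a::real_normed_vector set"
  assumes "open U"
  shows "open {x. closed_segment a x \<subseteq> U}"
  unfolding open_dist
proof (intro ballI)
  fix x assume "x \<in> {x. closed_segment a x \<subseteq> U}"
  then have "closed_segment a x \<subseteq> U" by simp
  from this obtain e where e: "e > 0" "(\<Union>y\<in>closed_segment a x. ball y e) \<subseteq> U"
    using compact_subset_open_imp_ball_epsilon_subset[OF compact_segment assms] by metis
  have "closed_segment a y \<subseteq> U" if "dist y x < e" for y
  proof
    fix z assume "z \<in> closed_segment a y"
    then obtain t where t: "0 \<le> t" "t \<le> 1" "z = (1 - t) *\<^sub>R a + t *\<^sub>R y"
      by (auto simp: in_segment)
    define w where "w = (1 - t) *\<^sub>R a + t *\<^sub>R x"
    have "dist w z = t * dist y x"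
      using t by (simp add: w_def dist_norm flip: scaleR_diff_right) (simp add: norm_minus_commute)
    also have "\<dots> \<le> 1 * dist y x"
      using t by (intro mult_right_mono) auto
    finally have "z \<in> ball w e" using that by simp
    moreover have "w \<in> closed_segment a x"
      using t by (auto simp: w_def in_segment)
    ultimately show "z \<in> U" using e by blast
  qed
  then show "\<exists>e>0. \<forall>y. dist y x < e \<longrightarrow> y \<in> {x. closed_segment a x \<subseteq> U}"
    using e(1) by blast
qed

text \<open>
  The set of points seen from \<open>a\<close> is open but not relatively closed in \<open>U\<close>; approaching one of
  its missing limit points off the line of sight sweeps out a triangle.
\<close>

lemma nonconvex_sweep:
  fixes U :: "complex set"
  assumes "open U" "connected U" "\<not> convex U"
  obtains a c d where "a \<in> U" "c \<in> U" "det2 (c - a) (d - a) \<noteq> 0"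
    "\<not> closed_segment a c \<subseteq> U"
    "\<And>t. 0 < t \<Longrightarrow> t \<le> 1 \<Longrightarrow> closed_segment a (c + t *\<^sub>R (d - c)) \<subseteq> U"
proof -
  obtain a b where ab: "a \<in> U" "b \<in> U" "\<not> closed_segment a b \<subseteq> U"
    using assms(3) convex_contains_segment by blast
  define V where "V = {x. closed_segment a x \<subseteq> U}"
  have V: "open V" unfolding V_def by (rule star_open[OF assms(1)])
  have VU: "V \<subseteq> U" by (auto simp: V_def)
  have "a \<in> V" "b \<notin> V" using ab by (auto simp: V_def)
  have "\<not> U \<inter> closure V \<subseteq> V"
  proof
    assume *: "U \<inter> closure V \<subseteq> V"
    then have "U \<inter> V = U \<inter> closure V" using closure_subset by blast
    then have "openin (top_of_set U) V" "closedin (top_of_set U) V"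
      using V VU by (auto simp: openin_open closedin_closed)
    then show False
      using assms(2) \<open>a \<in> V\<close> \<open>b \<notin> V\<close> \<open>b \<in> U\<close> unfolding connected_clopen by blast
  qed
  then obtain c0 where c0: "c0 \<in> U" "c0 \<in> closure V" "c0 \<notin> V" by blast
  then have "c0 \<noteq> a" using \<open>a \<in> V\<close> by blast
  obtain r where r: "r > 0" "ball c0 r \<subseteq> U"
    using assms(1) c0(1) openE by blast
  obtain y where y0: "y \<in> ball c0 r \<inter> V"
    using c0(2) r(1) unfolding closure_approachable by (auto simp: dist_commute)
  moreover have "open (ball c0 r \<inter> V)" using V by blast
  ultimately obtain s where y: "y \<in> ball c0 r \<inter> V" "s > 0" "ball y s \<subseteq> ball c0 r \<inter> V"
    using openE by blast
  obtain d where d: "d \<in> ball c0 r" "d \<in> V" "det2 (c0 - a) (d - a) \<noteq> 0"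
  proof (cases "det2 (c0 - a) (y - a) = 0")
    case True
    \<comment> \<open>A nudge perpendicular to \<open>c0 - a\<close> takes \<open>y\<close> off the
      line of sight; its length \<open>s / 2\<close> keeps it in the ball around \<open>y\<close>
      within \<open>V\<close>.\<close>
    define h where "h = (s / 2 / norm (c0 - a)) *\<^sub>R (\<i> * (c0 - a))"
    have n: "norm (c0 - a) > 0" using \<open>c0 \<noteq> a\<close> by simp
    have "norm h = s / 2" using n y(2) by (simp add: h_def norm_mult)
    then have yh: "y + h \<in> ball y s" using y(2) by (simp add: dist_norm)
    have "det2 (c0 - a) (\<i> * (c0 - a)) = (norm (c0 - a))^2"
      unfolding cmod_power2 by (simp add: det2_def power2_eq_square algebra_simps)
    moreover have "det2 (c0 - a) (y + h - a) = det2 (c0 - a) (y - a) + det2 (c0 - a) h"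
      by (simp add: det2_simps)
    ultimately have "det2 (c0 - a) (y + h - a) = s / 2 * norm (c0 - a)"
      using True n by (simp add: h_def det2_simps(8) power2_eq_square)
    then have "det2 (c0 - a) (y + h - a) \<noteq> 0"
      using mult_pos_pos[of "s / 2" "norm (c0 - a)"] n y(2) by linarith
    moreover have "y + h \<in> ball c0 r" "y + h \<in> V" using y(3) yh by blast+
    ultimately show ?thesis
      by (intro that[of "y + h"])
  qed (use y that in blast)
  define f where "f s = d + s *\<^sub>R (c0 - d)" for s :: real
  have contf: "continuous_on S f" for S unfolding f_def by (intro continuous_intros)
  \<comment> \<open>Points between \<open>d\<close> and \<open>c0\<close> may already be hidden from
    \<open>a\<close>, so the first hidden point on the way from \<open>d\<close> replaces
    \<open>c0\<close>. It is still in \<open>U\<close>, because the ball around \<open>c0\<close> is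
    convex.\<close>
  define W where "W = {0..1} \<inter> f -` (- V)"
  have "closed W"
    unfolding W_def using V contf by (intro continuous_closed_preimage) auto
  then have "compact W"
    unfolding W_def by (metis bounded_Int bounded_closed_interval compact_eq_bounded_closed)
  moreover have "1 \<in> W" using c0 by (simp add: W_def f_def)
  ultimately obtain s0 where s0: "s0 \<in> W" "\<And>s. s \<in> W \<Longrightarrow> s0 \<le> s"
    using compact_attains_inf[of W] by blast
  have "s0 \<noteq> 0" using s0(1) d(2) by (auto simp: W_def f_def)
  then have s01: "0 < s0" "s0 \<le> 1" using s0(1) by (auto simp: W_def)
  define c where "c = f s0"
  have "c \<in> closed_segment d c0"
    using s01 unfolding c_def f_def in_segment by (intro exI[of _ s0]) (auto simp: algebra_simps)
  then have "c \<in> ball c0 r"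
    using d(1) r(1) convex_ball closed_segment_subset centre_in_ball by (metis subsetD)
  moreover have "c \<notin> V" using s0(1) by (simp add: W_def c_def)
  moreover have "closed_segment a (c + t *\<^sub>R (d - c)) \<subseteq> U" if "0 < t" "t \<le> 1" for t
  proof -
    define r where "r = (1 - t) * s0"
    have "c + t *\<^sub>R (d - c) = f r"
      by (simp add: c_def f_def r_def algebra_simps)
    moreover have r: "r < s0" "0 \<le> r" using that s01 by (auto simp: r_def algebra_simps)
    then have "r \<notin> W" using s0(2)[of r] by auto
    ultimately show ?thesis using r s01(2) by (simp add: W_def V_def)
  qed
  moreover have "det2 (c - a) (d - a) = s0 * det2 (c0 - a) (d - a)"
    by (simp add: c_def f_def det2_def algebra_simps)
  then have "det2 (c - a) (d - a) \<noteq> 0" using d(3) s01(1) by simp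
  moreover have "c \<in> U" using \<open>c \<in> ball c0 r\<close> r(2) by blast
  moreover have "\<not> closed_segment a c \<subseteq> U" using \<open>c \<notin> V\<close> by (simp add: V_def)
  ultimately show ?thesis
    using ab(1) by (intro that[of a c d])
qed

text \<open>The swept triangle with corners \<open>a\<close>, \<open>c\<close>, \<open>d\<close>
  lies in \<open>U\<close> except perhaps for its side from \<open>a\<close> to \<open>c\<close>.
  The boundary point \<open>z\<close> of that side nearest to \<open>a\<close> is strictly between
  its ends, so a half disc at \<open>z\<close> on the side of \<open>d\<close> is contained in
  \<open>U\<close>. The last property records that \<open>z\<close> is the first hit, seen from
  \<open>a\<close>.\<close>

lemma nonconvex_half_disc:
  fixes U :: "complex set"
  assumes "open U" "connected U" "\<not> convex U"
  obtains z e \<tau> \<epsilon> where "z \<in> frontier U" "e \<noteq> 0" "\<tau> \<noteq> 0" "\<epsilon> > 0"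
    "\<And>y. dist y z < \<epsilon> \<Longrightarrow> det2 e (y - z) > 0 \<Longrightarrow> y \<in> U"
    "\<And>\<delta>. 0 < \<delta> \<Longrightarrow> \<delta> < \<epsilon> \<Longrightarrow> z + (\<delta> * \<tau>) *\<^sub>R e \<notin> frontier U"
proof -
  obtain a c d where acd: "a \<in> U" "c \<in> U" "det2 (c - a) (d - a) \<noteq> 0"
    "\<not> closed_segment a c \<subseteq> U"
    "\<And>t. 0 < t \<Longrightarrow> t \<le> 1 \<Longrightarrow> closed_segment a (c + t *\<^sub>R (d - c)) \<subseteq> U"
    using nonconvex_sweep[OF assms] by blast
  define D where "D = det2 (c - a) (d - a)"
  have D: "D \<noteq> 0" using acd(3) by (simp add: D_def)
  have int: "interior U = U" using assms(1) by (simp add: interior_open)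
  \<comment> \<open>Points at the same fraction \<open>s\<close> of the visible segments converge to
    this one as their far ends tend to \<open>c\<close>.\<close>
  have clos: "a + s *\<^sub>R (c - a) \<in> closure U" if "0 \<le> s" "s \<le> 1" for s
  proof -
    define f where "f t = a + s *\<^sub>R (c + t *\<^sub>R (d - c) - a)" for t :: real
    have "f ` {0<..<1} \<subseteq> U"
    proof (clarify)
      fix t :: real assume t: "t \<in> {0<..<1}"
      have "f t \<in> closed_segment a (c + t *\<^sub>R (d - c))"
        unfolding in_segment f_def using that by (intro exI[of _ s]) (auto simp: algebra_simps)
      then show "f t \<in> U" using acd(5)[of t] t by auto
    qed
    then have "f ` closure {0<..<1} \<subseteq> closure U"
      using closure_subset[of U] unfolding f_def
      by (intro image_closure_subset) (auto intro!: continuous_intros)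
    then have "f 0 \<in> closure U" by (auto simp: closure_greaterThanLessThan)
    then show ?thesis by (simp add: f_def)
  qed
  define g where "g s = a + s *\<^sub>R (c - a)" for s :: real
  have contg: "continuous_on S g" for S unfolding g_def by (intro continuous_intros)
  define L where "L = {0..1} \<inter> g -` frontier U"
  have "closed L"
    unfolding L_def using contg by (intro continuous_closed_preimage) auto
  then have "compact L"
    unfolding L_def by (metis bounded_Int bounded_closed_interval compact_eq_bounded_closed)
  moreover have "L \<noteq> {}"
  proof -
    obtain w where w: "w \<in> closed_segment a c" "w \<notin> U" using acd(4) by blast
    then obtain s where s: "0 \<le> s" "s \<le> 1" "w = g s"
      by (auto simp: in_segment g_def algebra_simps)
    then have "w \<in> frontier U" using clos[of s] w(2) by (simp add: frontier_def int g_def)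
    then show ?thesis using s by (auto simp: L_def)
  qed
  ultimately obtain l where l: "l \<in> L" "\<And>s. s \<in> L \<Longrightarrow> l \<le> s"
    using compact_attains_inf[of L] by blast
  have "l \<noteq> 0" "l \<noteq> 1" using l(1) acd(1,2) by (auto simp: L_def g_def frontier_def int)
  then have l01: "0 < l" "l < 1" using l(1) by (auto simp: L_def)
  define z where "z = g l"
  define \<alpha> where "\<alpha> x = det2 (x - a) (d - a) / D" for x
  define \<beta> where "\<beta> x = det2 (c - a) (x - a) / D" for x
  have za: "z - a = l *\<^sub>R (c - a)" by (simp add: z_def g_def)
  have "\<alpha> z = l" "\<beta> z = 0"
    using D unfolding \<alpha>_def \<beta>_def za by (simp_all add: det2_simps(7-9) flip: D_def)
  \<comment> \<open>Close to \<open>z\<close> the other two sides of the triangle are out of reach,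
    and the sign of \<open>\<beta>\<close> alone decides membership.\<close>
  moreover have "open {x. 0 < \<alpha> x \<and> \<alpha> x + \<beta> x < 1}"
    unfolding \<alpha>_def \<beta>_def
    by (intro open_Collect_conj open_Collect_less continuous_intros) (use D in auto)
  ultimately obtain r where r: "r > 0" "\<And>y. dist y z < r \<Longrightarrow> 0 < \<alpha> y \<and> \<alpha> y + \<beta> y < 1"
    unfolding open_dist using l01 by force
  have U: "y \<in> U" if "dist y z < r" "\<beta> y > 0" for y
  proof -
    \<comment> \<open>The ray from \<open>a\<close> through \<open>y\<close> meets the side from
      \<open>c\<close> to \<open>d\<close> at parameter \<open>\<beta> y / s\<close>, and
      \<open>y\<close> is at fraction \<open>s\<close> of the way there.\<close>
    define s where "s = \<alpha> y + \<beta> y"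
    have s: "0 < s" "s < 1" using r(2)[OF that(1)] that(2) by (auto simp: s_def)
    have "y - a = \<alpha> y *\<^sub>R (c - a) + \<beta> y *\<^sub>R (d - a)"
      using det2_coordinates[of "c - a" "d - a" "y - a"] D by (simp add: \<alpha>_def \<beta>_def D_def)
    moreover have "\<alpha> y = s - s * (\<beta> y / s)" "\<beta> y = s * (\<beta> y / s)" using s by (auto simp: s_def)
    ultimately have "y - a = (s - s * (\<beta> y / s)) *\<^sub>R (c - a) + (s * (\<beta> y / s)) *\<^sub>R (d - a)"
      by metis
    then have "y = (1 - s) *\<^sub>R a + s *\<^sub>R (c + (\<beta> y / s) *\<^sub>R (d - c))"
      by (simp add: algebra_simps)
    then have "y \<in> closed_segment a (c + (\<beta> y / s) *\<^sub>R (d - c))"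
      using s unfolding in_segment by (intro exI[of _ s]) auto
    moreover have "0 < \<beta> y / s" "\<beta> y / s \<le> 1"
      using s r(2)[OF that(1)] that(2) by (auto simp: s_def)
    ultimately show ?thesis using acd(5) by blast
  qed
  \<comment> \<open>The sign of \<open>D\<close> orients \<open>e\<close> so that \<open>d\<close>
    lies on its positive side. With \<open>- sgn D\<close> as \<open>\<tau>\<close>, the multiples
    \<open>(\<delta> * \<tau>) *\<^sub>R e\<close> point back to \<open>a\<close>, and the bound
    \<open>l\<close> on \<open>\<epsilon>\<close> stops them before \<open>a\<close>.\<close>
  define e where "e = sgn D *\<^sub>R (c - a)"
  define \<epsilon> where "\<epsilon> = min r l"
  show thesis
  proof (rule that[of z e "- sgn D" \<epsilon>])
    show "z \<in> frontier U" using l(1) by (simp add: L_def z_def)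
    show "e \<noteq> 0" using acd(3) D by (auto simp: e_def det2_simps sgn_if)
    show "- sgn D \<noteq> 0" using D by (simp add: sgn_if)
    show "\<epsilon> > 0" using r l01 by (simp add: \<epsilon>_def)
    show "y \<in> U" if y: "dist y z < \<epsilon>" "det2 e (y - z) > 0" for y
    proof (rule U)
      have "det2 (sgn D *\<^sub>R h) (w - l *\<^sub>R h) = sgn D * det2 h w" for h w
        by (simp add: det2_simps(4,7,8,9))
      moreover have "y - z = (y - a) - l *\<^sub>R (c - a)" using za by (simp add: algebra_simps)
      ultimately have "det2 e (y - z) = sgn D * det2 (c - a) (y - a)"
        by (simp only: e_def)
      then show "\<beta> y > 0"
        using y(2) D by (auto simp: \<beta>_def sgn_if zero_less_divide_iff split: if_splits)
    qed (use y in \<open>simp add: \<epsilon>_def\<close>)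
    show "z + (\<delta> * (- sgn D)) *\<^sub>R e \<notin> frontier U" if "0 < \<delta>" "\<delta> < \<epsilon>" for \<delta>
    proof -
      have "sgn D * sgn D = 1" using D by (auto simp: sgn_if)
      then have "z + (\<delta> * (- sgn D)) *\<^sub>R e = z + (- \<delta>) *\<^sub>R (c - a)"
        by (simp add: e_def mult.assoc)
      also have "\<dots> = g (l - \<delta>)" by (simp add: z_def g_def algebra_simps)
      finally show ?thesis
        using that l(2)[of "l - \<delta>"] l01 by (force simp: L_def \<epsilon>_def)
    qed
  qed
qed

text \<open>If \<open>z\<close> were interior to the segment, the frontier would pass through
  \<open>z\<close> in both directions. A segment transversal to \<open>e\<close> would enter the
  half disc, hence the open set \<open>U\<close>; a segment parallel to \<open>e\<close> would
  contain points that \<open>first\<close> excludes.\<close>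

lemma half_disc_at_endpoint:
  fixes U :: "complex set"
  assumes U: "open U" and seg: "closed_segment p p' \<subseteq> frontier U" "p \<noteq> p'" "z \<in> closed_segment p p'"
    and e: "e \<noteq> 0" "\<tau> \<noteq> 0" "\<epsilon> > 0"
    and half: "\<And>y. dist y z < \<epsilon> \<Longrightarrow> det2 e (y - z) > 0 \<Longrightarrow> y \<in> U"
    and first: "\<And>\<delta>. 0 < \<delta> \<Longrightarrow> \<delta> < \<epsilon> \<Longrightarrow> z + (\<delta> * \<tau>) *\<^sub>R e \<notin> frontier U"
  shows "z \<in> {p, p'}"
proof (rule ccontr)
  assume "z \<notin> {p, p'}"
  with seg(3) have "z \<in> open_segment p p'" by (simp add: open_segment_def)
  then obtain t where t: "0 < t" "t < 1" "z = (1 - t) *\<^sub>R p + t *\<^sub>R p'"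
    by (auto simp: in_segment)
  define h where "h = p' - p"
  have h: "h \<noteq> 0" using seg(2) by (simp add: h_def)
  define m where "m = min t (1 - t)"
  have m: "m > 0" using t by (simp add: m_def)
  have fr: "z + \<eta> *\<^sub>R h \<in> frontier U" if "\<bar>\<eta>\<bar> \<le> m" for \<eta>
  proof -
    have "z + \<eta> *\<^sub>R h = (1 - (t + \<eta>)) *\<^sub>R p + (t + \<eta>) *\<^sub>R p'"
      by (simp add: t(3) h_def algebra_simps)
    moreover have "0 \<le> t + \<eta>" "t + \<eta> \<le> 1" using that by (auto simp: m_def)
    ultimately have "z + \<eta> *\<^sub>R h \<in> closed_segment p p'" unfolding in_segment by blast
    then show ?thesis using seg(1) by blast
  qed
  have "det2 e h = 0"
  proof (rule ccontr)
    assume n: "det2 e h \<noteq> 0"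
    define \<eta> where "\<eta> = min m (\<epsilon> / 2 / norm h)"
    have \<eta>: "\<eta> > 0" "\<eta> \<le> m" "\<eta> \<le> \<epsilon> / 2 / norm h" using m e h by (auto simp: \<eta>_def)
    then have "\<eta> * norm h \<le> \<epsilon> / 2" using h by (simp add: field_simps)
    define y where "y = z + (sgn (det2 e h) * \<eta>) *\<^sub>R h"
    have "dist y z < \<epsilon>"
      using n \<eta> e \<open>\<eta> * norm h \<le> \<epsilon> / 2\<close> by (auto simp: y_def dist_norm abs_mult sgn_if)
    moreover have "det2 e (y - z) = \<eta> * \<bar>det2 e h\<bar>"
      by (simp add: y_def det2_simps(8) abs_sgn)
    ultimately have "y \<in> U" using half n \<eta> by simp
    moreover have "y \<in> frontier U"
      unfolding y_def using n \<eta> by (intro fr) (auto simp: abs_mult sgn_if)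
    ultimately show False using U by (simp add: frontier_def interior_open)
  qed
  then obtain c where c: "h = c *\<^sub>R e" using det2_eq_0_iff[OF e(1)] by blast
  then have c0: "c \<noteq> 0" using h by auto
  define \<delta> where "\<delta> = min (\<epsilon> / 2) (m * \<bar>c\<bar> / \<bar>\<tau>\<bar>)"
  have \<delta>: "\<delta> > 0" "\<delta> < \<epsilon>" using e m c0 by (auto simp: \<delta>_def)
  have "\<delta> \<le> m * \<bar>c\<bar> / \<bar>\<tau>\<bar>" by (simp add: \<delta>_def)
  then have "\<bar>\<delta> * \<tau> / c\<bar> \<le> m"
    using \<delta>(1) c0 e(2) by (simp add: abs_mult abs_divide field_simps)
  then have "z + (\<delta> * \<tau> / c) *\<^sub>R h \<in> frontier U" by (rule fr)
  then show False using first[OF \<delta>] c c0 by simp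
qed

section \<open>Two reflex tips on one chain\<close>

text \<open>Here \<open>\<pi>\<close> stands for the chain of the other vertices, from
  \<open>u\<close> to \<open>v\<close>, which \<open>q\<close> closes to a polygon. With
  \<open>\<pi>\<close> an arbitrary set, only its topology enters the comparison of two
  tips.\<close>

definition spike :: "complex set \<Rightarrow> complex \<Rightarrow> complex \<Rightarrow> complex \<Rightarrow> complex set" where
  "spike \<pi> u v q = \<pi> \<union> closed_segment q u \<union> closed_segment q v"

text \<open>That the tip is reflex is expressed by an open half disc centred there within the polygon.\<close>

definition reflex_tip :: "complex set \<Rightarrow> complex \<Rightarrow> complex \<Rightarrow> complex \<Rightarrow> bool" where
  "reflex_tip \<pi> u v q \<longleftrightarrow> compact \<pi> \<and>
     \<pi> \<inter> closed_segment q u = {u} \<and> \<pi> \<inter> closed_segment q v = {v} \<and>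
     det2 (u - q) (v - q) \<noteq> 0 \<and>
     (\<exists>e \<epsilon>. e \<noteq> 0 \<and> \<epsilon> > 0 \<and>
        (\<forall>y. dist y q < \<epsilon> \<longrightarrow> det2 e (y - q) > 0 \<longrightarrow> y \<in> inside (spike \<pi> u v q)))"

lemma spike_commute: "spike \<pi> v u q = spike \<pi> u v q"
  by (auto simp: spike_def)

lemma reflex_tip_commute: "reflex_tip \<pi> v u q \<longleftrightarrow> reflex_tip \<pi> u v q"
  by (auto simp: reflex_tip_def spike_commute[of \<pi> v u] det2_commute[of "v - q"])

lemma inside_connected_subset:
  fixes P :: "complex set"
  assumes "connected C" "C \<inter> P = {}" "x \<in> C" "x \<in> inside P" "y \<in> C"
  shows "y \<in> inside P"
proof (rule inside_same_component)
  show "connected_component (- P) x y"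
    unfolding connected_component_def using assms by blast
qed (use assms in auto)

lemma in_segment_det2:
  assumes "y \<in> closed_segment q v"
  shows "det2 (y - q) (v - q) = 0" and "det2 (u - q) (y - q) * det2 (u - q) (v - q) \<ge> 0"
proof -
  obtain t where t: "0 \<le> t" "y - q = t *\<^sub>R (v - q)"
    using assms by (auto simp: in_segment algebra_simps)
  show "det2 (y - q) (v - q) = 0" unfolding t(2) det2_simps(7,9) by simp
  show "det2 (u - q) (y - q) * det2 (u - q) (v - q) \<ge> 0"
    unfolding t(2) det2_simps(8) using t(1) by (simp add: mult.assoc)
qed

text \<open>The reflex angle at \<open>q\<close> covers the side of the edge \<open>q v\<close> that
  faces away from \<open>u\<close>. A thin strip along that side, from \<open>q\<close> to
  \<open>x\<close>, misses the whole polygon: the chain has positive distance from it, one edge is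
  on the bounding line and the other beyond it. Being connected, the strip is inside as soon as one
  of its points lies in the half disc at \<open>q\<close>.\<close>

lemma reflex_sector:
  assumes tip: "reflex_tip \<pi> u v q" and x: "x \<in> closed_segment q v" "x \<noteq> v"
  obtains d where "d > 0"
    "\<And>y. dist y x < d \<Longrightarrow> det2 (y - q) (v - q) * det2 (u - q) (v - q) < 0
       \<Longrightarrow> y \<in> inside (spike \<pi> u v q)"
proof -
  define s where "s = det2 (u - q) (v - q)"
  have \<pi>: "compact \<pi>" "\<pi> \<inter> closed_segment q u = {u}" "\<pi> \<inter> closed_segment q v = {v}" "s \<noteq> 0"
    using tip by (auto simp: reflex_tip_def s_def)
  obtain e \<epsilon> where e: "e \<noteq> 0" "\<epsilon> > 0"
    "\<And>y. dist y q < \<epsilon> \<Longrightarrow> det2 e (y - q) > 0 \<Longrightarrow> y \<in> inside (spike \<pi> u v q)"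
    using tip unfolding reflex_tip_def by blast
  have sub: "closed_segment q x \<subseteq> closed_segment q v"
    using x(1) by (simp add: subset_closed_segment)
  have "v \<notin> closed_segment q x"
  proof
    assume "v \<in> closed_segment q x"
    then obtain r where r: "0 \<le> r" "r \<le> 1" "v - q = r *\<^sub>R (x - q)"
      by (auto simp: in_segment algebra_simps)
    obtain t where t: "0 \<le> t" "t \<le> 1" "x - q = t *\<^sub>R (v - q)"
      using x(1) by (auto simp: in_segment algebra_simps)
    have "t \<noteq> 1" using t(3) x(2) by auto
    then have "r * t < 1" using r(1,2) t(1,2) mult_left_le_one_le[of t r] by simp
    moreover have "(1 - r * t) *\<^sub>R (v - q) = 0" using r(3) t(3) by (simp add: scaleR_diff_left)
    ultimately have "v - q = 0" by simp
    then show False using \<pi>(4) by (simp only: s_def det2_simps(11))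
  qed
  have "closed_segment q x \<subseteq> - \<pi>"
  proof (intro subsetI ComplI)
    fix y assume "y \<in> closed_segment q x" "y \<in> \<pi>"
    then have "y \<in> \<pi> \<inter> closed_segment q v" using sub by (intro IntI) auto
    then show False using \<pi>(3) \<open>v \<notin> _\<close> \<open>y \<in> closed_segment q x\<close> by simp
  qed
  moreover have "open (- \<pi>)" using \<pi>(1) by (simp add: compact_imp_closed open_Compl)
  ultimately obtain d where d: "d > 0" "(\<Union>z\<in>closed_segment q x. ball z d) \<subseteq> - \<pi>"
    using compact_subset_open_imp_ball_epsilon_subset[OF compact_segment] by metis
  \<comment> \<open>A tube around the segment, written as a Minkowski sum, cut by an open half
    plane: both are convex, so connectedness is immediate.\<close>
  define N where "N = (\<Union>z\<in>closed_segment q x. \<Union>w\<in>ball 0 d. {z + w})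
      \<inter> {y. det2 (y - q) (v - q) * s < 0}"
  have ball: "y \<in> N" if "z \<in> closed_segment q x" "dist y z < d" "det2 (y - q) (v - q) * s < 0" for y z
  proof -
    have "y - z \<in> ball 0 d" using that(2) by (simp add: dist_norm norm_minus_commute)
    moreover have "y = z + (y - z)" by simp
    ultimately show ?thesis using that(1,3) unfolding N_def by blast
  qed
  have "N \<inter> \<pi> = {}"
  proof -
    have "N \<subseteq> (\<Union>z\<in>closed_segment q x. ball z d)"
      by (auto simp: N_def dist_norm norm_minus_commute)
    then show ?thesis using d(2) by blast
  qed
  moreover have "N \<inter> closed_segment q v = {}"
    using in_segment_det2(1) by (auto simp: N_def)
  moreover have "det2 (y - q) (v - q) * s \<ge> 0" if y: "y \<in> closed_segment q u" for y
    using in_segment_det2(2)[OF y, of v] by (simp add: s_def det2_commute[of "v - q"])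
  then have "N \<inter> closed_segment q u = {}" by (force simp: N_def)
  ultimately have disj: "N \<inter> spike \<pi> u v q = {}" by (auto simp: spike_def)
  have "{y. det2 (y - q) (v - q) * s < 0} = (\<lambda>y. det2 y (v - q) * s) -` {..< det2 q (v - q) * s}"
    by (auto simp: det2_simps(3) left_diff_distrib)
  moreover have "linear (\<lambda>y. det2 y (v - q) * s)"
    by (intro linearI) (simp_all add: det2_simps(1,7) algebra_simps)
  ultimately have "convex {y. det2 (y - q) (v - q) * s < 0}"
    by (simp add: convex_linear_vimage)
  then have "convex N"
    unfolding N_def by (intro convex_Int convex_sums) auto
  then have "connected N" by (rule convex_connected)
  \<comment> \<open>No edge at \<open>q\<close> can point into the half disc, since the half disc
    contains no boundary points.\<close>
  have side: "det2 e (w - q) \<le> 0" if w: "closed_segment q w \<subseteq> spike \<pi> u v q" "w \<noteq> q" for w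
  proof (rule ccontr)
    assume n: "\<not> det2 e (w - q) \<le> 0"
    define \<eta> where "\<eta> = min 1 (\<epsilon> / 2 / norm (w - q))"
    have \<eta>: "\<eta> > 0" "\<eta> \<le> 1" using e w by (auto simp: \<eta>_def)
    have "\<eta> \<le> \<epsilon> / 2 / norm (w - q)" by (simp add: \<eta>_def)
    then have "\<eta> * norm (w - q) \<le> \<epsilon> / 2" using w(2) by (simp add: field_simps)
    then have "dist (q + \<eta> *\<^sub>R (w - q)) q < \<epsilon>" using e(2) \<eta> by (simp add: dist_norm)
    moreover have "det2 e (q + \<eta> *\<^sub>R (w - q) - q) > 0" using n \<eta> by (simp add: det2_simps(8))
    ultimately have "q + \<eta> *\<^sub>R (w - q) \<in> inside (spike \<pi> u v q)" by (rule e(3))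
    moreover have "q + \<eta> *\<^sub>R (w - q) \<in> closed_segment q w"
      unfolding in_segment using \<eta> by (intro exI[of _ \<eta>]) (simp add: algebra_simps)
    ultimately show False using w(1) inside_no_overlap[of "spike \<pi> u v q"] by blast
  qed
  have "u \<noteq> q" "v \<noteq> q" using \<pi>(4) by (auto simp: s_def det2_simps)
  then have le: "det2 e (u - q) \<le> 0" "det2 e (v - q) \<le> 0"
    by (auto intro!: side simp: spike_def)
  have "\<not> (det2 e (u - q) = 0 \<and> det2 e (v - q) = 0)"
  proof
    assume "det2 e (u - q) = 0 \<and> det2 e (v - q) = 0"
    then obtain a b where "u - q = a *\<^sub>R e" "v - q = b *\<^sub>R e"
      using det2_eq_0_iff[OF e(1)] by blast
    then show False using \<pi>(4) by (simp add: s_def det2_simps)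
  qed
  with le have lt: "det2 e (u - q) + det2 e (v - q) < 0" by linarith
  \<comment> \<open>The direction \<open>- h\<close> opposite to the sum of both edge vectors points
    into the half disc and also away from \<open>u\<close> across the line \<open>q v\<close>, so a
    small step along it reaches both \<open>N\<close> and the half disc.\<close>
  define h where "h = (u - q) + (v - q)"
  have h: "det2 h (v - q) = s" "det2 e h < 0"
    using lt by (simp_all only: h_def s_def det2_simps(1,2,9))
  then have "h \<noteq> 0" using \<pi>(4) by (auto simp: det2_simps)
  define \<eta> where "\<eta> = min d \<epsilon> / 2 / norm h"
  have \<eta>: "\<eta> > 0" "\<eta> * norm h = min d \<epsilon> / 2" using d(1) e(2) \<open>h \<noteq> 0\<close> by (auto simp: \<eta>_def)
  define y0 where "y0 = q - \<eta> *\<^sub>R h"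
  have "dist y0 q = min d \<epsilon> / 2" using \<eta> by (simp add: y0_def dist_norm)
  then have y0: "dist y0 q < d" "dist y0 q < \<epsilon>" using d(1) e(2) by auto
  have y0q: "y0 - q = (- \<eta>) *\<^sub>R h" by (simp add: y0_def)
  have "det2 e (y0 - q) > 0" unfolding y0q det2_simps(8) using \<eta>(1) h(2) by (simp add: mult_pos_neg)
  then have "y0 \<in> inside (spike \<pi> u v q)" using y0(2) e(3) by blast
  moreover have ss: "s * s > 0" using \<pi>(4) not_real_square_gt_zero by blast
  have "det2 (y0 - q) (v - q) * s < 0"
    using mult_neg_pos[OF _ ss, of "- \<eta>"] \<eta>(1) by (simp only: y0q det2_simps(7) h(1) mult.assoc)
  then have "y0 \<in> N" using y0(1) by (intro ball[of q]) auto
  ultimately show thesis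
    using inside_connected_subset[OF \<open>connected N\<close> disj] ball[of x]
    by (intro that[of d] d(1)) (auto simp: s_def)
qed

text \<open>The signs put \<open>q'\<close> beyond the line \<open>q v\<close>, seen from
  \<open>u\<close>, and \<open>a + b < 1\<close> in the present coefficients makes the segment from
  \<open>q'\<close> to \<open>u\<close> cross the edge \<open>q v\<close> before \<open>v\<close>.
  Up to the crossing it misses both edges at \<open>q\<close> by its side, and \<open>\<pi>\<close>
  because it is an edge at the other tip. Just before the crossing it is inside by
  \<open>reflex_sector\<close>, hence so is its start \<open>q'\<close>.\<close>

lemma crossing_tip:
  assumes q: "reflex_tip \<pi> u v q" and q': "reflex_tip \<pi> u v q'"
    and ab: "q' - q = \<alpha> *\<^sub>R (u - q) + \<beta> *\<^sub>R (v - q)" "\<alpha> < 0" "\<beta> > 0" "\<alpha> + \<beta> < 1"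
  shows "q' \<in> inside (spike \<pi> u v q)"
proof -
  define s where "s = det2 (u - q) (v - q)"
  have s: "s \<noteq> 0" using q by (simp add: reflex_tip_def s_def)
  \<comment> \<open>The zero of the coefficient \<open>\<alpha> * (1 - t) + t\<close> of
    \<open>u - q\<close>. The other coefficient is then \<open>\<beta> / (1 - \<alpha>)\<close>,
    which is below 1 exactly because \<open>\<alpha> + \<beta> < 1\<close>.\<close>
  define t0 where "t0 = - \<alpha> / (1 - \<alpha>)"
  have t0: "0 < t0" "t0 < 1" using ab by (auto simp: t0_def field_simps)
  define f where "f t = q' + t *\<^sub>R (u - q')" for t
  have f: "f t - q = (\<alpha> * (1 - t) + t) *\<^sub>R (u - q) + (\<beta> * (1 - t)) *\<^sub>R (v - q)" for t
  proof -
    have "f t - q = t *\<^sub>R (u - q) + (1 - t) *\<^sub>R (q' - q)" by (simp add: f_def algebra_simps)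
    then show ?thesis unfolding ab(1) by (simp add: algebra_simps)
  qed
  have det: "det2 (f t - q) (v - q) = (\<alpha> * (1 - t) + t) * s" for t
    unfolding f det2_simps(1,7,9) s_def by simp
  have neg: "\<alpha> * (1 - t) + t < 0" if "t < t0" for t
    using that ab(2) by (simp add: t0_def field_simps)
  have "\<alpha> * (1 - t0) + t0 = 0" using ab(2) by (simp add: t0_def field_simps)
  moreover have b1: "0 < \<beta> * (1 - t0)" "\<beta> * (1 - t0) < 1"
    using ab t0 by (auto simp: t0_def field_simps)
  ultimately have x: "f t0 - q = (\<beta> * (1 - t0)) *\<^sub>R (v - q)" unfolding f by simp
  have "f t0 = (1 - \<beta> * (1 - t0)) *\<^sub>R q + (\<beta> * (1 - t0)) *\<^sub>R v"
    using x by (simp add: algebra_simps)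
  then have "f t0 \<in> closed_segment q v"
    unfolding in_segment using b1 by (intro exI[of _ "\<beta> * (1 - t0)"]) auto
  moreover have "f t0 \<noteq> v"
  proof
    assume "f t0 = v"
    with x have "(1 - \<beta> * (1 - t0)) *\<^sub>R (v - q) = 0" by (simp add: algebra_simps)
    then have "v = q" using b1 by simp
    then show False using s by (simp add: s_def det2_simps)
  qed
  ultimately obtain d where d: "d > 0"
    "\<And>y. dist y (f t0) < d \<Longrightarrow> det2 (y - q) (v - q) * s < 0 \<Longrightarrow> y \<in> inside (spike \<pi> u v q)"
    using reflex_sector[OF q] unfolding s_def by metis
  define M where "M = f ` {0..<t0}"
  have "connected M"
    unfolding M_def f_def by (intro connected_continuous_image continuous_intros) auto
  have ss: "s * s > 0" using s not_real_square_gt_zero by blast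
  have negs: "det2 (f t - q) (v - q) * s < 0" if "t < t0" for t
    using mult_neg_pos[OF neg[OF that] ss] by (simp only: det mult.assoc)
  have "M \<inter> spike \<pi> u v q = {}"
  proof -
    have "f t \<notin> spike \<pi> u v q" if t: "0 \<le> t" "t < t0" for t
    proof -
      have "f t \<in> closed_segment q' u"
        unfolding in_segment f_def using t t0 by (intro exI[of _ t]) (simp add: algebra_simps)
      moreover have "f t \<noteq> u"
      proof
        assume "f t = u"
        then have "(1 - t) *\<^sub>R (u - q') = 0" by (auto simp: f_def algebra_simps)
        then have "u = q'" using t t0 by simp
        then show False using q' by (simp add: reflex_tip_def det2_simps)
      qed
      ultimately have "f t \<notin> \<pi>" using q' by (auto simp: reflex_tip_def)
      moreover have "f t \<notin> closed_segment q v"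
        using in_segment_det2(1)[of "f t" q v] negs[OF t(2)] by auto
      moreover have "f t \<notin> closed_segment q u"
        using in_segment_det2(2)[of "f t" q u v] negs[OF t(2)]
        by (auto simp: s_def det2_commute[of "v - q"])
      ultimately show ?thesis by (simp add: spike_def)
    qed
    then show ?thesis by (auto simp: M_def)
  qed
  moreover define \<eta> where "\<eta> = min t0 (d / 2 / (1 + norm (u - q')))"
  have n: "1 + norm (u - q') > 0" using norm_ge_zero[of "u - q'"] by linarith
  then have \<eta>: "\<eta> > 0" "\<eta> \<le> t0" using t0 d by (auto simp: \<eta>_def)
  have "\<eta> \<le> d / 2 / (1 + norm (u - q'))" by (simp add: \<eta>_def)
  then have "\<eta> * (1 + norm (u - q')) \<le> d / 2" using n by (simp add: field_simps)
  then have "\<eta> * norm (u - q') < d" using \<eta>(1) d(1) by (simp add: algebra_simps)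
  moreover have "f (t0 - \<eta>) - f t0 = (- \<eta>) *\<^sub>R (u - q')" by (simp add: f_def algebra_simps)
  ultimately have "dist (f (t0 - \<eta>)) (f t0) < d" using \<eta>(1) by (simp add: dist_norm)
  then have "f (t0 - \<eta>) \<in> inside (spike \<pi> u v q)" using negs[of "t0 - \<eta>"] \<eta> by (intro d(2)) auto
  moreover have "f (t0 - \<eta>) \<in> M" "f 0 \<in> M" using \<eta> t0 by (auto simp: M_def)
  ultimately have "f 0 \<in> inside (spike \<pi> u v q)"
    using inside_connected_subset[OF \<open>connected M\<close> \<open>M \<inter> spike \<pi> u v q = {}\<close>] by blast
  then show ?thesis by (simp add: f_def)
qed


text \<open>The complement of a convex set has no bounded component, so a curve within
  \<open>T\<close> cannot enclose a point off \<open>T\<close>. It is applied to a half plane and to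
  the region above the parabola.\<close>

lemma inside_subset_convex:
  fixes P :: "complex set"
  assumes "convex T" "P \<subseteq> T"
  shows "inside P \<subseteq> T"
  using inside_mono[OF assms(2)] inside_convex[OF assms(1)] by auto

text \<open>
  The four segments joining \<open>q\<close> and \<open>q'\<close> to \<open>u\<close> and \<open>v\<close> bound a quadrilateral that \<open>\<pi>\<close> cannot
  enter or leave. If \<open>\<pi>\<close> is within, the tip \<open>q\<close> is convex rather than reflex; if it is
  outside, the tip \<open>q'\<close> sees \<open>q\<close> from the inside of its polygon.
\<close>

lemma nested_tip:
  assumes q: "reflex_tip \<pi> u v q" and q': "reflex_tip \<pi> u v q'"
    and conn: "connected (\<pi> - {u, v})"
    and ab: "q' - q = a *\<^sub>R (u - q) + b *\<^sub>R (v - q)" "a > 0" "b > 0" "a + b < 1"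
  shows "q \<in> inside (spike \<pi> u v q')"
proof -
  define s where "s = det2 (u - q) (v - q)"
  have s: "s \<noteq> 0" using q by (simp add: reflex_tip_def s_def)
  define \<alpha> where "\<alpha> y = det2 (y - q) (v - q) / s" for y
  define \<beta> where "\<beta> y = det2 (u - q) (y - q) / s" for y
  have coord: "y - q = \<alpha> y *\<^sub>R (u - q) + \<beta> y *\<^sub>R (v - q)" for y
    using det2_coordinates[of "u - q" "v - q" "y - q"] s by (simp add: \<alpha>_def \<beta>_def s_def)
  have unique: "\<alpha> y = c" "\<beta> y = d" if "y - q = c *\<^sub>R (u - q) + d *\<^sub>R (v - q)" for y c d
    using s unfolding \<alpha>_def \<beta>_def that det2_simps(1,2,7,8,9) by (simp_all add: s_def)
  have cont: "continuous_on UNIV \<alpha>" "continuous_on UNIV \<beta>"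
    unfolding \<alpha>_def \<beta>_def using s by (auto intro!: continuous_intros)
  note cont' = continuous_on_subset[OF cont(1) subset_UNIV] continuous_on_subset[OF cont(2) subset_UNIV]
  \<comment> \<open>In the coordinates at \<open>q\<close>, the line through \<open>u\<close> and
    \<open>q'\<close> is \<open>b * (1 - \<alpha>) = (1 - a) * \<beta>\<close>, and likewise for
    \<open>v\<close>. As \<open>q'\<close> lies in the triangle \<open>q\<close>, \<open>u\<close>,
    \<open>v\<close>, the quadrilateral is reflex at \<open>q'\<close>: its interior
    \<open>Q\<close> is a union of two triangles, whence the disjunction, and its exterior
    \<open>R\<close> needs a conjunction.\<close>
  define Q where "Q = {y. \<alpha> y > 0 \<and> \<beta> y > 0 \<and>
    (b * (1 - \<alpha> y) > (1 - a) * \<beta> y \<or> a * (1 - \<beta> y) > (1 - b) * \<alpha> y)}"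
  define R where "R = {y. \<alpha> y < 0 \<or> \<beta> y < 0 \<or> \<alpha> y + \<beta> y > 1 \<or>
    (b * (1 - \<alpha> y) < (1 - a) * \<beta> y \<and> a * (1 - \<beta> y) < (1 - b) * \<alpha> y)}"
  have "open Q" "open R"
    unfolding Q_def R_def
    by (intro open_Collect_conj open_Collect_disj open_Collect_less continuous_intros cont')+
  have "Q \<inter> R = {}"
  proof -
    have False if y: "y \<in> Q" "\<alpha> y + \<beta> y > 1" for y
    proof -
      have "\<alpha> y > 0" "\<beta> y > 0" using y by (auto simp: Q_def)
      then have "b * (1 - \<alpha> y) \<le> b * \<beta> y" "b * \<beta> y \<le> (1 - a) * \<beta> y"
        "a * (1 - \<beta> y) \<le> a * \<alpha> y" "a * \<alpha> y \<le> (1 - b) * \<alpha> y"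
        using y(2) ab by auto
      then show False using y(1) by (auto simp: Q_def)
    qed
    then show ?thesis by (force simp: Q_def R_def)
  qed
  have on_segment: "y \<in> closed_segment p w" if "y - p = t *\<^sub>R (w - p)" "0 \<le> t" "t \<le> 1"
    for p w y :: complex and t
    unfolding in_segment using that by (intro exI[of _ t]) (simp add: algebra_simps)
  define B where "B = closed_segment q u \<union> closed_segment q v \<union> closed_segment q' u \<union> closed_segment q' v"
  have cover: "y \<in> B" if y: "y \<notin> Q" "y \<notin> R" for y
  proof -
    have R: "\<alpha> y \<ge> 0" "\<beta> y \<ge> 0" "\<alpha> y + \<beta> y \<le> 1"
      using y(2) by (auto simp: R_def)
    consider "\<alpha> y = 0" | "\<beta> y = 0"
      | "b * (1 - \<alpha> y) = (1 - a) * \<beta> y" "a * (1 - \<beta> y) \<le> (1 - b) * \<alpha> y"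
      | "b * (1 - \<alpha> y) \<le> (1 - a) * \<beta> y" "a * (1 - \<beta> y) = (1 - b) * \<alpha> y"
      using y R by (force simp: Q_def R_def)
    then show ?thesis
    proof cases
      case 1
      then have "y \<in> closed_segment q v" using R coord[of y] by (intro on_segment[of _ _ "\<beta> y"]) auto
      then show ?thesis by (simp add: B_def)
    next
      case 2
      then have "y \<in> closed_segment q u" using R coord[of y] by (intro on_segment[of _ _ "\<alpha> y"]) auto
      then show ?thesis by (simp add: B_def)
    next
      case 3
      define t where "t = (1 - \<alpha> y) / (1 - a)"
      have t: "\<alpha> y = 1 - t * (1 - a)" "\<beta> y = t * b"
        using 3(1) ab by (auto simp: t_def field_simps)
      have "(1 - a - b) * t \<le> (1 - a - b) * 1" using 3(2) unfolding t by (simp add: algebra_simps)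
      then have "t \<le> 1" using ab by (simp only: mult_le_cancel_left_pos)
      moreover have "t \<ge> 0" using R ab by (simp add: t_def)
      moreover have "y - u = t *\<^sub>R (q' - u)"
      proof -
        have "y - u = (\<alpha> y *\<^sub>R (u - q) + \<beta> y *\<^sub>R (v - q)) - (u - q)"
          unfolding coord[of y, symmetric] by simp
        also have "\<dots> = t *\<^sub>R ((a *\<^sub>R (u - q) + b *\<^sub>R (v - q)) - (u - q))"
          unfolding t by (simp add: algebra_simps)
        finally show ?thesis unfolding ab(1)[symmetric] by simp
      qed
      ultimately have "y \<in> closed_segment u q'" using on_segment[of y u t q'] by blast
      then show ?thesis by (simp add: B_def closed_segment_commute)
    next
      case 4
      define t where "t = (1 - \<beta> y) / (1 - b)"
      have t: "\<beta> y = 1 - t * (1 - b)" "\<alpha> y = t * a"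
        using 4(2) ab by (auto simp: t_def field_simps)
      have "(1 - a - b) * t \<le> (1 - a - b) * 1" using 4(1) unfolding t by (simp add: algebra_simps)
      then have "t \<le> 1" using ab by (simp only: mult_le_cancel_left_pos)
      moreover have "t \<ge> 0" using R ab by (simp add: t_def)
      moreover have "y - v = t *\<^sub>R (q' - v)"
      proof -
        have "y - v = (\<alpha> y *\<^sub>R (u - q) + \<beta> y *\<^sub>R (v - q)) - (v - q)"
          unfolding coord[of y, symmetric] by simp
        also have "\<dots> = t *\<^sub>R ((a *\<^sub>R (u - q) + b *\<^sub>R (v - q)) - (v - q))"
          unfolding t by (simp add: algebra_simps)
        finally show ?thesis unfolding ab(1)[symmetric] by simp
      qed
      ultimately have "y \<in> closed_segment v q'" using on_segment[of y v t q'] by blast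
      then show ?thesis by (simp add: B_def closed_segment_commute)
    qed
  qed
  have \<pi>: "\<pi> \<inter> closed_segment q u = {u}" "\<pi> \<inter> closed_segment q v = {v}"
    "\<pi> \<inter> closed_segment q' u = {u}" "\<pi> \<inter> closed_segment q' v = {v}"
    using q q' by (auto simp: reflex_tip_def)
  have "(\<pi> - {u, v}) \<inter> B = {}" using \<pi> unfolding B_def by auto
  then have sub: "\<pi> - {u, v} \<subseteq> Q \<union> R" using cover by blast
  have "\<pi> - {u, v} \<subseteq> R"
  proof (rule ccontr)
    assume "\<not> \<pi> - {u, v} \<subseteq> R"
    then have "Q \<inter> (\<pi> - {u, v}) \<noteq> {}" using sub by blast
    then have "R \<inter> (\<pi> - {u, v}) = {}"
      using connectedD[OF conn \<open>open Q\<close> \<open>open R\<close> _ sub] \<open>Q \<inter> R = {}\<close> by blast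
    then have pQ: "\<pi> - {u, v} \<subseteq> Q" using sub by blast
    \<comment> \<open>With the chain in the quadrilateral the whole polygon, hence its interior,
      lies in a half plane bounded by the line \<open>q v\<close>; yet \<open>reflex_sector\<close>
      at \<open>q\<close> yields interior points beyond that line.\<close>
    have "\<alpha> y \<ge> 0" if y: "y \<in> spike \<pi> u v q" for y
    proof -
      have "\<alpha> y \<ge> 0" if "y \<in> closed_segment q u"
        using in_segment_det2(2)[OF that, of v] s unfolding \<alpha>_def zero_le_divide_iff
        by (auto simp: s_def det2_commute[of "v - q"] zero_le_mult_iff)
      moreover have "\<alpha> y \<ge> 0" if "y \<in> closed_segment q v"
        using in_segment_det2(1)[OF that] by (simp add: \<alpha>_def)
      moreover have "y \<in> closed_segment q u \<or> y \<in> closed_segment q v \<or> y \<in> \<pi> - {u, v}"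
        using y by (auto simp: spike_def)
      ultimately show ?thesis using pQ by (auto simp: Q_def)
    qed
    then have P: "spike \<pi> u v q \<subseteq> {y. \<alpha> y \<ge> 0}" by blast
    have "{y. \<alpha> y \<ge> 0} = (\<lambda>y. det2 y (v - q) / s) -` {det2 q (v - q) / s ..}"
      by (auto simp: \<alpha>_def det2_simps(3) diff_divide_distrib)
    moreover have "linear (\<lambda>y. det2 y (v - q) / s)"
      by (intro linearI) (simp_all add: det2_simps(1,7) add_divide_distrib)
    ultimately have "convex {y. \<alpha> y \<ge> 0}" by (simp add: convex_linear_vimage)
    then have insP: "inside (spike \<pi> u v q) \<subseteq> {y. \<alpha> y \<ge> 0}" using P by (rule inside_subset_convex)
    have "v \<noteq> q" using s by (auto simp: s_def det2_simps)
    then obtain d where d: "d > 0"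
      "\<And>y. dist y q < d \<Longrightarrow> det2 (y - q) (v - q) * det2 (u - q) (v - q) < 0
         \<Longrightarrow> y \<in> inside (spike \<pi> u v q)"
      using reflex_sector[OF q, of q] by auto
    define \<eta> where "\<eta> = d / 2 / (1 + norm (u - q))"
    have n: "1 + norm (u - q) > 0" using norm_ge_zero[of "u - q"] by linarith
    then have \<eta>: "\<eta> > 0" using d by (auto simp: \<eta>_def)
    have "\<eta> * (1 + norm (u - q)) = d / 2"
      using nonzero_eq_divide_eq[THEN iffD1, OF _ \<eta>_def] n by simp
    then have "\<eta> * norm (u - q) < d" using \<eta>(1) d(1) by (simp add: algebra_simps)
    define y where "y = q - \<eta> *\<^sub>R (u - q)"
    have "dist y q < d" using \<open>\<eta> * norm (u - q) < d\<close> \<eta> by (simp add: y_def dist_norm)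
    moreover have y: "y - q = (- \<eta>) *\<^sub>R (u - q)" by (simp add: y_def)
    have "s * s > 0" using s not_real_square_gt_zero by blast
    then have "det2 (y - q) (v - q) * s < 0"
      using mult_neg_pos[of "- \<eta>" "s * s"] \<eta> by (simp only: y det2_simps(7) s_def mult.assoc)
    ultimately have "y \<in> inside (spike \<pi> u v q)" using d(2) by (simp add: s_def)
    moreover have "\<alpha> y = - \<eta>" using unique(1)[of y "- \<eta>" 0] y by simp
    ultimately show False using \<eta> insP by auto
  qed
  define f where "f t = q' + t *\<^sub>R (q - q')" for t
  have f: "f t - q = (a * (1 - t)) *\<^sub>R (u - q) + (b * (1 - t)) *\<^sub>R (v - q)" for t
  proof -
    have "f t - q = (1 - t) *\<^sub>R (q' - q)" by (simp add: f_def algebra_simps)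
    then show ?thesis unfolding ab(1) by (simp add: algebra_simps)
  qed
  define s' where "s' = det2 (u - q') (v - q')"
  have s': "s' \<noteq> 0" using q' by (simp add: reflex_tip_def s'_def)
  \<comment> \<open>Seen from \<open>q'\<close>, the point \<open>q\<close> lies in the cone
    opposite to the one spanned by \<open>u\<close> and \<open>v\<close>, so the segment from
    \<open>q'\<close> to \<open>q\<close> starts within the reflex angle at
    \<open>q'\<close>.\<close>
  have tip: "(1 - a - b) *\<^sub>R (q - q') = (- a) *\<^sub>R (u - q') + (- b) *\<^sub>R (v - q')"
    using ab(1) by (simp add: algebra_simps)
  have "(1 - a - b) * det2 (q - q') (v - q') = - a * s'"
    using arg_cong[OF tip, of "\<lambda>x. det2 x (v - q')"] unfolding det2_simps(1,7,9) by (simp add: s'_def)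
  then have dv: "det2 (q - q') (v - q') = - (a / (1 - a - b)) * s'" using ab by (simp add: field_simps)
  have "(1 - a - b) * det2 (u - q') (q - q') = - b * s'"
    using arg_cong[OF tip, of "det2 (u - q')"] unfolding det2_simps(2,8,9) by (simp add: s'_def)
  then have du: "det2 (u - q') (q - q') = - (b / (1 - a - b)) * s'" using ab by (simp add: field_simps)
  have ss: "s' * s' > 0" using s' not_real_square_gt_zero by blast
  have f': "f t - q' = t *\<^sub>R (q - q')" for t by (simp add: f_def)
  have negv: "det2 (f t - q') (v - q') * s' < 0" if "t > 0" for t
    using mult_neg_pos[OF _ ss, of "- (t * (a / (1 - a - b)))"] that ab
    unfolding f' det2_simps(7) dv by (simp add: algebra_simps)
  have negu: "det2 (u - q') (f t - q') * s' < 0" if "t > 0" for t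
    using mult_neg_pos[OF _ ss, of "- (t * (b / (1 - a - b)))"] that ab
    unfolding f' det2_simps(8) du by (simp add: algebra_simps)
  \<comment> \<open>The tip \<open>q'\<close> itself is on the boundary and is left out. All further
    points before \<open>q\<close> lie in \<open>Q\<close>, where the chain is absent; the endpoint
    \<open>q\<close> is off the chain for a separate reason.\<close>
  define M where "M = f ` {0<..1}"
  have "connected M"
    unfolding M_def f_def by (intro connected_continuous_image continuous_intros) auto
  have "f t \<notin> spike \<pi> u v q'" if t: "0 < t" "t \<le> 1" for t
  proof -
    have "f t \<notin> closed_segment q' v"
      using in_segment_det2(1)[of "f t" q' v] negv[OF t(1)] by auto
    moreover have "f t \<notin> closed_segment q' u"
      using in_segment_det2(1)[of "f t" q' u] negu[OF t(1)] by (auto simp: det2_commute[of _ "u - q'"])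
    moreover have "f t \<notin> \<pi>"
    proof (cases "t = 1")
      case True
      have "u \<noteq> q" using s by (auto simp: s_def det2_simps)
      then have "q \<notin> \<pi>" using \<pi>(1) by auto
      then show ?thesis using True by (simp add: f_def)
    next
      case False
      have "\<alpha> (f t) = a * (1 - t)" "\<beta> (f t) = b * (1 - t)" using unique[OF f] by auto
      moreover have "(1 - a) * (b * (1 - t)) = b * (1 - a * (1 - t)) - b * t"
        by (simp add: algebra_simps)
      ultimately have "f t \<in> Q" using t False ab by (simp add: Q_def)
      then have "f t \<notin> \<pi> - {u, v}" using \<open>\<pi> - {u, v} \<subseteq> R\<close> \<open>Q \<inter> R = {}\<close> by blast
      moreover have "f t \<noteq> u" "f t \<noteq> v"
        using \<open>f t \<notin> closed_segment q' u\<close> \<open>f t \<notin> closed_segment q' v\<close> by auto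
      ultimately show ?thesis by blast
    qed
    ultimately show ?thesis by (simp add: spike_def)
  qed
  then have M: "M \<inter> spike \<pi> u v q' = {}" by (auto simp: M_def)
  have "v \<noteq> q'" using s' by (auto simp: s'_def det2_simps)
  then obtain d where d: "d > 0"
    "\<And>y. dist y q' < d \<Longrightarrow> det2 (y - q') (v - q') * s' < 0 \<Longrightarrow> y \<in> inside (spike \<pi> u v q')"
    using reflex_sector[OF q', of q'] unfolding s'_def by auto
  define \<eta> where "\<eta> = min 1 (d / 2 / (1 + norm (q - q')))"
  have n: "1 + norm (q - q') > 0" using norm_ge_zero[of "q - q'"] by linarith
  then have \<eta>: "\<eta> > 0" "\<eta> \<le> 1" using d by (auto simp: \<eta>_def)
  have "\<eta> \<le> d / 2 / (1 + norm (q - q'))" by (simp add: \<eta>_def)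
  then have "\<eta> * (1 + norm (q - q')) \<le> d / 2" using n by (simp add: field_simps)
  then have "\<eta> * norm (q - q') < d" using \<eta>(1) d(1) by (simp add: algebra_simps)
  then have "dist (f \<eta>) q' < d" using \<eta>(1) by (simp add: f_def dist_norm)
  then have "f \<eta> \<in> inside (spike \<pi> u v q')" using negv \<eta> by (intro d(2)) auto
  moreover have "f \<eta> \<in> M" "f 1 \<in> M" using \<eta> by (auto simp: M_def)
  ultimately have "f 1 \<in> inside (spike \<pi> u v q')"
    using inside_connected_subset[OF \<open>connected M\<close> M] by blast
  then show ?thesis by (simp add: f_def)
qed

text \<open>Opposite signs of \<open>a\<close> and \<open>b\<close> let an edge at \<open>q'\<close>
  cross an edge at \<open>q\<close>; equal signs put one tip into the triangle of the other. Each
  pattern gives a tip inside the polygon of the other one.\<close>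

lemma reflex_tip_unique:
  assumes q: "reflex_tip \<pi> u v q" and q': "reflex_tip \<pi> u v q'"
    and conn: "connected (\<pi> - {u, v})"
    and empty: "q' \<notin> inside (spike \<pi> u v q)" "q \<notin> inside (spike \<pi> u v q')"
    and side: "det2 (u - q) (v - q) * det2 (u - q') (v - q') > 0"
    and gp: "det2 (q' - q) (v - q) \<noteq> 0" "det2 (u - q) (q' - q) \<noteq> 0"
  shows False
proof -
  define s where "s = det2 (u - q) (v - q)"
  have s: "s \<noteq> 0" using q by (simp add: reflex_tip_def s_def)
  define a where "a = det2 (q' - q) (v - q) / s"
  define b where "b = det2 (u - q) (q' - q) / s"
  have ab: "q' - q = a *\<^sub>R (u - q) + b *\<^sub>R (v - q)"
    using det2_coordinates[of "u - q" "v - q" "q' - q"] s by (simp add: a_def b_def s_def)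
  have ne: "a \<noteq> 0" "b \<noteq> 0" using gp s by (auto simp: a_def b_def)
  \<comment> \<open>The signed area of the triangle \<open>q'\<close>, \<open>u\<close>,
    \<open>v\<close> is what remains of that of \<open>q\<close>, \<open>u\<close>,
    \<open>v\<close>, so \<open>1 - a - b\<close> is the barycentric weight of \<open>q\<close> in
    \<open>q'\<close>.\<close>
  have "det2 (u - q') (v - q') = det2 (u - q) (v - q) - det2 (q' - q) (v - q) - det2 (u - q) (q' - q)"
    by (simp add: det2_def algebra_simps)
  also have "\<dots> = (1 - a - b) * s"
    using s by (simp add: a_def b_def field_simps flip: s_def)
  finally have "(1 - a - b) * (s * s) > 0" using side by (simp add: s_def mult_ac)
  moreover have "s * s > 0" using s not_real_square_gt_zero by blast
  ultimately have sum: "a + b < 1" by (simp add: zero_less_mult_iff)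
  have ba: "q' - q = b *\<^sub>R (v - q) + a *\<^sub>R (u - q)" using ab by simp
  consider "a < 0" "b > 0" | "a > 0" "b < 0" | "a > 0" "b > 0" | "a < 0" "b < 0"
    using ne by linarith
  then show False
  proof cases
    case 1
    then show False using crossing_tip[OF q q' ab] sum empty(1) by blast
  next
    case 2
    have "q' \<in> inside (spike \<pi> v u q)"
      using crossing_tip[of \<pi> v u q q' b a] q q' ba 2 sum by (simp add: reflex_tip_commute[of \<pi> v u])
    then show False using empty(1) by (simp add: spike_commute)
  next
    case 3
    then show False using nested_tip[OF q q' conn ab] sum empty(2) by blast
  next
    case 4
    \<comment> \<open>In the basis at \<open>q'\<close>, the point \<open>q\<close> has the positive
      coefficients \<open>- a / r\<close> and \<open>- b / r\<close>: the tips trade places in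
      \<open>nested_tip\<close>.\<close>
    define r where "r = 1 - a - b"
    have r: "r > 0" using sum by (simp add: r_def)
    have "r *\<^sub>R (q - q') = (- a) *\<^sub>R (u - q') + (- b) *\<^sub>R (v - q')"
      using ab by (simp add: r_def algebra_simps)
    then have "(1 / r) *\<^sub>R r *\<^sub>R (q - q') = (1 / r) *\<^sub>R ((- a) *\<^sub>R (u - q') + (- b) *\<^sub>R (v - q'))"
      by simp
    then have "q - q' = (- a / r) *\<^sub>R (u - q') + (- b / r) *\<^sub>R (v - q')"
      using r by (simp add: scaleR_right_distrib scaleR_right_diff_distrib)
    moreover have "(- a + - b) / r < 1" using r by (simp add: r_def)
    then have "- a / r + - b / r < 1" by (simp only: add_divide_distrib)
    moreover have "- a / r > 0" "- b / r > 0" using 4 r by (auto simp: divide_neg_pos)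
    ultimately show False using nested_tip[OF q' q conn] empty(1) by blast
  qed
qed

section \<open>Polygons as vertex lists\<close>

text \<open>As long as the closing edge is left out, each new edge meets the earlier ones at the
  joint only, so the join is again an arc.\<close>

lemma polygon_arc:
  assumes vs: "simple_polygon vs" and m: "1 \<le> m" "m < length vs"
  shows "\<exists>g. arc g \<and> pathstart g = vs ! 0 \<and> pathfinish g = vs ! m \<and>
    path_image g = (\<Union>i<m. edge vs i)"
  using m
proof (induction m rule: nat_induct_at_least)
  case base
  have "distinct vs" using vs by (simp add: simple_polygon_def)
  then have "vs ! 0 \<noteq> vs ! 1" using base nth_eq_iff_index_eq[of vs 0 1] by force
  then show ?case using base by (intro exI[of _ "linepath (vs ! 0) (vs ! 1)"]) (auto simp: edge_def)
next
  case (Suc m)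
  then obtain g where g: "arc g" "pathstart g = vs ! 0" "pathfinish g = vs ! m"
    "path_image g = (\<Union>i<m. edge vs i)" by auto
  have d: "distinct vs" using vs by (simp add: simple_polygon_def)
  have e: "edge vs m = closed_segment (vs ! m) (vs ! Suc m)" using Suc.prems by (simp add: edge_def)
  have "edge vs i \<inter> edge vs m \<subseteq> {vs ! m}" if "i < m" for i
  proof -
    have "edge vs i \<inter> edge vs m = edge_ends vs i \<inter> edge_ends vs m"
      using vs that Suc.prems unfolding simple_polygon_def by auto
    also have "\<dots> \<subseteq> {vs ! m}"
      using that Suc.prems d by (auto simp: edge_ends_def nth_eq_iff_index_eq)
    finally show ?thesis .
  qed
  moreover have "vs ! m \<noteq> vs ! Suc m" using Suc.prems d by (simp add: nth_eq_iff_index_eq)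
  ultimately have "arc (g +++ linepath (vs ! m) (vs ! Suc m))"
    using g by (intro arc_join) (auto simp: e[symmetric])
  moreover have "path_image (g +++ linepath (vs ! m) (vs ! Suc m)) = (\<Union>i<Suc m. edge vs i)"
    using g by (subst path_image_join) (auto simp: e[symmetric] lessThan_Suc)
  ultimately show ?case using g by (intro exI[of _ "g +++ linepath (vs ! m) (vs ! Suc m)"]) simp
qed

text \<open>The closing edge completes the arc of all other edges to a simple closed path, to which
  the Jordan curve theorem applies.\<close>

lemma polygon_Jordan:
  assumes vs: "simple_polygon vs"
  shows "inside (polygon_boundary vs) \<noteq> {}" "open (inside (polygon_boundary vs))"
    "connected (inside (polygon_boundary vs))"
    "frontier (inside (polygon_boundary vs)) = polygon_boundary vs"
proof -
  define m where "m = length vs - 1"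
  have m: "2 \<le> m" "length vs = Suc m" using vs by (auto simp: simple_polygon_def m_def)
  have d: "distinct vs" using vs by (simp add: simple_polygon_def)
  obtain g where g: "arc g" "pathstart g = vs ! 0" "pathfinish g = vs ! m"
    "path_image g = (\<Union>i<m. edge vs i)" using polygon_arc[OF vs, of m] m by auto
  have e: "edge vs m = closed_segment (vs ! m) (vs ! 0)" using m by (simp add: edge_def)
  have "edge vs i \<inter> edge vs m \<subseteq> {vs ! 0, vs ! m}" if "i < m" for i
  proof -
    have "edge vs i \<inter> edge vs m = edge_ends vs i \<inter> edge_ends vs m"
      using vs that m unfolding simple_polygon_def by auto
    also have "\<dots> \<subseteq> {vs ! 0, vs ! m}" using m by (auto simp: edge_ends_def)
    finally show ?thesis .
  qed
  moreover have "vs ! m \<noteq> vs ! 0" using m d by (simp add: nth_eq_iff_index_eq)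
  ultimately have "simple_path (g +++ linepath (vs ! m) (vs ! 0))"
    using g by (intro simple_path_join_loop) (auto simp: e[symmetric])
  moreover have "path_image (g +++ linepath (vs ! m) (vs ! 0)) = polygon_boundary vs"
    using g m by (subst path_image_join) (auto simp: e[symmetric] polygon_boundary_def lessThan_Suc)
  ultimately show "inside (polygon_boundary vs) \<noteq> {}" "open (inside (polygon_boundary vs))"
    "connected (inside (polygon_boundary vs))"
    "frontier (inside (polygon_boundary vs)) = polygon_boundary vs"
    using Jordan_inside_outside[of "g +++ linepath (vs ! m) (vs ! 0)"] g by auto
qed

definition open_chain :: "complex list \<Rightarrow> complex set" where
  "open_chain xs = (\<Union>i<length xs - 1. closed_segment (xs ! i) (xs ! Suc i))"

lemma open_chain_rev: "open_chain (rev xs) = open_chain xs"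
proof -
  define n where "n = length xs - 1"
  have "closed_segment (rev xs ! i) (rev xs ! Suc i) =
      closed_segment (xs ! (n - Suc i)) (xs ! Suc (n - Suc i))" if "i < n" for i
  proof -
    have "rev xs ! i = xs ! Suc (n - Suc i)" "rev xs ! Suc i = xs ! (n - Suc i)"
      using that by (auto simp: rev_nth n_def Suc_diff_Suc intro!: arg_cong[of _ _ "nth xs"])
    then show ?thesis by (simp add: closed_segment_commute)
  qed
  then have "open_chain (rev xs) =
      (\<Union>i\<in>(\<lambda>i. n - Suc i) ` {..<n}. closed_segment (xs ! i) (xs ! Suc i))"
    unfolding open_chain_def length_rev n_def[symmetric] image_image by (intro SUP_cong) auto
  moreover have "(\<lambda>i. n - Suc i) ` {..<n} = {..<n}"
  proof (intro equalityI subsetI)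
    fix i assume "i \<in> {..<n}"
    then show "i \<in> (\<lambda>i. n - Suc i) ` {..<n}" by (intro image_eqI[of _ _ "n - Suc i"]) auto
  qed auto
  ultimately have "open_chain (rev xs) = (\<Union>i<n. closed_segment (xs ! i) (xs ! Suc i))"
    by (simp only:)
  then show ?thesis by (simp only: open_chain_def n_def)
qed

lemma edge_snoc:
  assumes "length xs \<ge> 2"
  shows "i < length xs - 1 \<Longrightarrow> edge (xs @ [q]) i = closed_segment (xs ! i) (xs ! Suc i)"
    "i < length xs - 1 \<Longrightarrow> edge_ends (xs @ [q]) i = {xs ! i, xs ! Suc i}"
    "edge (xs @ [q]) (length xs - 1) = closed_segment q (last xs)"
    "edge_ends (xs @ [q]) (length xs - 1) = {q, last xs}"
    "edge (xs @ [q]) (length xs) = closed_segment q (hd xs)"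
    "edge_ends (xs @ [q]) (length xs) = {q, hd xs}"
proof -
  obtain m where m: "length xs = Suc m" "m \<ge> 1"
    using assms by (cases "length xs") auto
  then have "xs \<noteq> []" by auto
  then have hl: "hd xs = xs ! 0" "last xs = xs ! m"
    using m by (simp_all add: hd_conv_nth last_conv_nth)
  show "i < length xs - 1 \<Longrightarrow> edge (xs @ [q]) i = closed_segment (xs ! i) (xs ! Suc i)"
    "i < length xs - 1 \<Longrightarrow> edge_ends (xs @ [q]) i = {xs ! i, xs ! Suc i}"
    using m by (simp_all add: edge_def edge_ends_def nth_append)
  show "edge (xs @ [q]) (length xs - 1) = closed_segment q (last xs)"
    "edge_ends (xs @ [q]) (length xs - 1) = {q, last xs}"
    "edge (xs @ [q]) (length xs) = closed_segment q (hd xs)"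
    "edge_ends (xs @ [q]) (length xs) = {q, hd xs}"
    using m by (simp_all add: edge_def edge_ends_def nth_append hl closed_segment_commute insert_commute)
qed

lemma polygon_boundary_snoc:
  assumes "length xs \<ge> 2"
  shows "polygon_boundary (xs @ [q]) = spike (open_chain xs) (hd xs) (last xs) q"
proof -
  have "{..<length (xs @ [q])} = insert (length xs) (insert (length xs - 1) {..<length xs - 1})"
    using assms by auto
  then show ?thesis
    unfolding polygon_boundary_def spike_def open_chain_def
    using edge_snoc[OF assms, where q = q] by auto
qed

lemma polygon_rotate1:
  shows "polygon_boundary (rotate1 vs) = polygon_boundary vs"
    and "simple_polygon vs \<Longrightarrow> simple_polygon (rotate1 vs)"
proof -
  define k where "k = length vs"
  have e: "edge (rotate1 vs) i = edge vs (Suc i mod k)"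
    "edge_ends (rotate1 vs) i = edge_ends vs (Suc i mod k)" if "i < k" for i
  proof -
    have "Suc i mod k < k" using that by simp
    then show "edge (rotate1 vs) i = edge vs (Suc i mod k)"
      "edge_ends (rotate1 vs) i = edge_ends vs (Suc i mod k)"
      using that by (auto simp: edge_def edge_ends_def nth_rotate1 k_def)
  qed
  have "(\<lambda>i. Suc i mod k) ` {..<k} = {..<k}"
  proof (intro equalityI subsetI)
    fix j assume "j \<in> {..<k}"
    then show "j \<in> (\<lambda>i. Suc i mod k) ` {..<k}"
      by (intro image_eqI[of _ _ "if j = 0 then k - 1 else j - 1"]) auto
  qed auto
  then have "(\<Union>j\<in>(\<lambda>i. Suc i mod k) ` {..<k}. edge vs j) = (\<Union>i<k. edge vs i)"
    by (simp only:)
  then have "(\<Union>i<k. edge vs (Suc i mod k)) = (\<Union>i<k. edge vs i)"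
    by (simp only: image_image)
  then show "polygon_boundary (rotate1 vs) = polygon_boundary vs"
    using e by (simp add: polygon_boundary_def k_def)
  show "simple_polygon (rotate1 vs)" if vs: "simple_polygon vs"
    unfolding simple_polygon_def
  proof (intro conjI allI impI)
    fix i j assume ij: "i < length (rotate1 vs)" "j < length (rotate1 vs)" "i \<noteq> j"
    then have "Suc i mod k < k" "Suc j mod k < k" "Suc i mod k \<noteq> Suc j mod k"
      by (auto simp: k_def mod_Suc split: if_splits)
    then show "edge (rotate1 vs) i \<inter> edge (rotate1 vs) j = edge_ends (rotate1 vs) i \<inter> edge_ends (rotate1 vs) j"
      using vs ij e unfolding simple_polygon_def k_def by simp
  qed (use vs in \<open>auto simp: simple_polygon_def\<close>)
qed

lemma polygon_rotate:
  shows "polygon_boundary (rotate m vs) = polygon_boundary vs"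
    and "simple_polygon vs \<Longrightarrow> simple_polygon (rotate m vs)"
  by (induction m) (auto simp: polygon_rotate1)

text \<open>The closed region of a polygon is the closure of its interior, so the interior is not
  convex either. The half disc found there is centred on some edge, and
  \<open>half_disc_at_endpoint\<close> forces the centre to be a vertex.\<close>

lemma nonconvex_polygon_reflex_vertex:
  assumes vs: "simple_polygon vs" and nc: "\<not> convex_polygon (polygon_boundary vs)"
  obtains xs q e \<epsilon> where "simple_polygon (xs @ [q])" "polygon_boundary (xs @ [q]) = polygon_boundary vs"
    "length vs = Suc (length xs)" "set vs = insert q (set xs)" "e \<noteq> 0" "\<epsilon> > 0"
    "\<And>y. dist y q < \<epsilon> \<Longrightarrow> det2 e (y - q) > 0 \<Longrightarrow> y \<in> inside (polygon_boundary vs)"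
proof -
  define U where "U = inside (polygon_boundary vs)"
  note J = polygon_Jordan[OF vs, folded U_def]
  have k: "length vs \<ge> 3" "distinct vs" using vs by (auto simp: simple_polygon_def)
  have "polygon_boundary vs \<union> U = closure U" using closure_Un_frontier[of U] J(4) by blast
  then have "\<not> convex U" using nc convex_closure unfolding convex_polygon_def U_def by metis
  then obtain z e \<tau> \<epsilon> where z: "z \<in> frontier U" "e \<noteq> 0" "\<tau> \<noteq> 0" "\<epsilon> > 0"
    "\<And>y. dist y z < \<epsilon> \<Longrightarrow> det2 e (y - z) > 0 \<Longrightarrow> y \<in> U"
    "\<And>\<delta>. 0 < \<delta> \<Longrightarrow> \<delta> < \<epsilon> \<Longrightarrow> z + (\<delta> * \<tau>) *\<^sub>R e \<notin> frontier U"
    using nonconvex_half_disc[OF J(2,3)] by metis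
  obtain i where i: "i < length vs" "z \<in> edge vs i"
    using z(1) unfolding J(4) polygon_boundary_def by auto
  have s: "Suc i mod length vs < length vs" "Suc i mod length vs \<noteq> i"
    using i k by (auto simp: mod_Suc)
  have "edge vs i \<subseteq> frontier U" using i unfolding J(4) polygon_boundary_def by auto
  then have "z \<in> {vs ! i, vs ! (Suc i mod length vs)}"
    using i s k z by (intro half_disc_at_endpoint[OF J(2)]) (auto simp: edge_def nth_eq_iff_index_eq)
  then obtain j where j: "j < length vs" "z = vs ! j" using i s by blast
  \<comment> \<open>Rotating by \<open>j\<close> brings the vertex to the front; one more step puts
    it last, in the role of the tip.\<close>
  define ws where "ws = rotate (Suc j) vs"
  have ws: "length ws = length vs" "set ws = set vs" "ws \<noteq> []" using k by (auto simp: ws_def)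
  have "last ws = vs ! ((Suc j + (length vs - 1)) mod length vs)"
    using k ws unfolding last_conv_nth[OF ws(3)] by (subst ws_def, subst nth_rotate) auto
  also have "(Suc j + (length vs - 1)) mod length vs = (j + length vs) mod length vs"
    using k by (intro arg_cong2[of _ _ _ _ "(mod)"]) auto
  also have "\<dots> = j" using j(1) by simp
  finally have "ws = butlast ws @ [z]" using j ws by (metis append_butlast_last_id)
  moreover have "simple_polygon ws" "polygon_boundary ws = polygon_boundary vs"
    unfolding ws_def using vs by (simp_all only: polygon_rotate)
  moreover have "set ws = insert z (set (butlast ws))"
    using \<open>ws = butlast ws @ [z]\<close> by (metis Un_insert_right empty_set list.simps(15) set_append sup_bot_right)
  ultimately show thesis
    using z k ws by (intro that[of "butlast ws" z e \<epsilon>]) (auto simp: U_def)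
qed

text \<open>Simplicity says that the two edges at \<open>q\<close> touch the chain at its ends only,
  and the chain, being an arc, stays connected without its endpoints.\<close>

lemma polygon_reflex_tip:
  assumes P: "simple_polygon (xs @ [q])" and n: "length xs \<ge> 3"
    and nd: "det2 (hd xs - q) (last xs - q) \<noteq> 0"
    and half: "e \<noteq> 0" "\<epsilon> > 0"
      "\<And>y. dist y q < \<epsilon> \<Longrightarrow> det2 e (y - q) > 0 \<Longrightarrow> y \<in> inside (polygon_boundary (xs @ [q]))"
  shows "reflex_tip (open_chain xs) (hd xs) (last xs) q"
    "connected (open_chain xs - {hd xs, last xs})"
proof -
  define m where "m = length xs - 1"
  have m: "m \<ge> 2" "length xs = Suc m" using n by (auto simp: m_def)
  have "2 \<le> length xs" using n by simp
  note es = edge_snoc[OF this, where q = q, folded m_def, unfolded m(2)]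
  have d: "distinct xs" "q \<notin> set xs" using P by (auto simp: simple_polygon_def)
  have hl: "hd xs = xs ! 0" "last xs = xs ! m"
    using hd_conv_nth[of xs] last_conv_nth[of xs] m \<open>2 \<le> length xs\<close> by (cases "xs = []"; simp)+
  have chain: "open_chain xs = (\<Union>i<m. edge (xs @ [q]) i)"
    using es(1) m by (simp add: open_chain_def)
  have int: "edge (xs @ [q]) i \<inter> edge (xs @ [q]) j = edge_ends (xs @ [q]) i \<inter> edge_ends (xs @ [q]) j"
    if "i \<noteq> j" "i \<le> Suc m" "j \<le> Suc m" for i j
    using P that m unfolding simple_polygon_def by simp
  have q: "xs ! i \<noteq> q" if "i \<le> m" for i using d(2) that m by (metis le_imp_less_Suc nth_mem)
  have "open_chain xs \<inter> closed_segment q (hd xs) \<subseteq> {hd xs}"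
  proof -
    have "edge (xs @ [q]) i \<inter> closed_segment q (hd xs) \<subseteq> {hd xs}" if "i < m" for i
      using int[of i "Suc m"] es(2,5,6) that m d q by (auto simp: hl nth_eq_iff_index_eq)
    then show ?thesis unfolding chain by blast
  qed
  moreover have "open_chain xs \<inter> closed_segment q (last xs) \<subseteq> {last xs}"
  proof -
    have "edge (xs @ [q]) i \<inter> closed_segment q (last xs) \<subseteq> {last xs}" if "i < m" for i
      using int[of i m] es(2,3,4) that m d q by (auto simp: hl nth_eq_iff_index_eq)
    then show ?thesis unfolding chain by blast
  qed
  moreover obtain g where g: "arc g" "pathstart g = (xs @ [q]) ! 0" "pathfinish g = (xs @ [q]) ! m"
    "path_image g = open_chain xs"
    using polygon_arc[OF P, of m] m unfolding chain by auto
  then have ends: "pathstart g = hd xs" "pathfinish g = last xs"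
    using m by (auto simp: hl nth_append)
  then have "hd xs \<in> open_chain xs" "last xs \<in> open_chain xs"
    using g(4) pathstart_in_path_image pathfinish_in_path_image by metis+
  moreover have "compact (open_chain xs)"
    unfolding open_chain_def by (intro compact_UN) auto
  moreover have "polygon_boundary (xs @ [q]) = spike (open_chain xs) (hd xs) (last xs) q"
    using n by (intro polygon_boundary_snoc) auto
  ultimately show "reflex_tip (open_chain xs) (hd xs) (last xs) q"
    unfolding reflex_tip_def using nd half by auto
  show "connected (open_chain xs - {hd xs, last xs})"
    using connected_simple_path_endless[OF arc_imp_simple_path[OF g(1)]] g(4) ends by simp
qed


section \<open>The upper bound\<close>

text \<open>A relation rather than a function, since a hole may have several reflex vertices. The
  count needs that every hole has a code and that no list is the code of two holes.\<close>

definition hole_code :: "complex set \<Rightarrow> nat \<Rightarrow> complex set \<Rightarrow> complex list \<Rightarrow> bool" where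
  "hole_code S m P xs \<longleftrightarrow> length xs = m \<and> distinct xs \<and> set xs \<subseteq> S \<and> inside P \<inter> S = {} \<and>
     (\<exists>q. q \<in> S \<and> q \<notin> set xs \<and> P = spike (open_chain xs) (hd xs) (last xs) q \<and>
        reflex_tip (open_chain xs) (hd xs) (last xs) q \<and>
        connected (open_chain xs - {hd xs, last xs}) \<and>
        det2 (hd xs - q) (last xs - q) > 0)"

text \<open>Reversing the chain swaps its ends, so one of the two directions has the reflex vertex on the left.\<close>

lemma hole_code_exists:
  assumes P: "P \<in> nonconvex_k_holes k S" and S: "general_position S" and k: "k \<ge> 4"
  shows "\<exists>xs. hole_code S (k - 1) P xs"
proof -
  obtain vs where vs: "P = polygon_boundary vs" "length vs = k" "set vs \<subseteq> S" "simple_polygon vs"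
    and hole: "inside P \<inter> S = {}" and nc: "\<not> convex_polygon P"
    using P by (auto simp: nonconvex_k_holes_def k_holes_def k_gons_def)
  obtain xs q e \<epsilon> where xs: "simple_polygon (xs @ [q])" "polygon_boundary (xs @ [q]) = P"
    "length vs = Suc (length xs)" "set vs = insert q (set xs)" "e \<noteq> 0" "\<epsilon> > 0"
    "\<And>y. dist y q < \<epsilon> \<Longrightarrow> det2 e (y - q) > 0 \<Longrightarrow> y \<in> inside P"
    using nonconvex_polygon_reflex_vertex[OF vs(4)] nc unfolding vs(1) by metis
  have n: "length xs = k - 1" "length xs \<ge> 3" using xs(3) vs(2) k by auto
  then have "xs \<noteq> []" by auto
  have d: "distinct xs" "q \<notin> set xs" using xs(1) by (auto simp: simple_polygon_def)
  have sub: "set xs \<subseteq> S" "q \<in> S" using xs(4) vs(3) by auto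
  have "hd xs \<noteq> last xs"
    using d(1) n(2) \<open>xs \<noteq> []\<close> by (simp add: hd_conv_nth last_conv_nth nth_eq_iff_index_eq)
  moreover have "hd xs \<in> set xs" "last xs \<in> set xs" using \<open>xs \<noteq> []\<close> by auto
  ultimately have "\<not> collinear {q, hd xs, last xs}"
    using S sub d(2) unfolding general_position_def by (metis subsetD)
  then have nd: "det2 (hd xs - q) (last xs - q) \<noteq> 0" by (simp add: collinear_iff_det2)
  have tip: "reflex_tip (open_chain xs) (hd xs) (last xs) q"
    "connected (open_chain xs - {hd xs, last xs})"
    using polygon_reflex_tip[OF xs(1) n(2) nd xs(5,6)] xs(2,7) by auto
  have spike: "P = spike (open_chain xs) (hd xs) (last xs) q"
    using polygon_boundary_snoc[of xs q] n(2) xs(2) by simp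
  show ?thesis
  proof (cases "det2 (hd xs - q) (last xs - q) > 0")
    case True
    then have "hole_code S (k - 1) P xs"
      unfolding hole_code_def using n d sub hole tip spike by blast
    then show ?thesis by blast
  next
    case False
    then have "det2 (last xs - q) (hd xs - q) > 0" using nd det2_commute[of "last xs - q"] by simp
    moreover have "hd (rev xs) = last xs" "last (rev xs) = hd xs"
      by (simp_all add: hd_rev last_rev)
    ultimately have "hole_code S (k - 1) P (rev xs)"
      unfolding hole_code_def open_chain_rev using n d sub hole tip spike
      by (auto simp: spike_commute reflex_tip_commute insert_commute)
    then show ?thesis by blast
  qed
qed

text \<open>Both tips are points of \<open>S\<close> and both holes are empty, so neither tip is
  inside the polygon of the other; the positive determinants put them on the same side.\<close>

lemma hole_code_unique:
  assumes S: "general_position S" and m: "m \<ge> 2"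
    and P: "hole_code S m P xs" and P': "hole_code S m P' xs"
  shows "P = P'"
proof -
  define u where "u = hd xs"
  define v where "v = last xs"
  define \<pi> where "\<pi> = open_chain xs"
  have xs: "length xs = m" "distinct xs" "set xs \<subseteq> S" using P by (auto simp: hole_code_def)
  then have "xs \<noteq> []" using m by auto
  obtain q where q: "q \<in> S" "q \<notin> set xs" "P = spike \<pi> u v q" "reflex_tip \<pi> u v q"
    "connected (\<pi> - {u, v})" "det2 (u - q) (v - q) > 0" "inside P \<inter> S = {}"
    using P unfolding hole_code_def u_def v_def \<pi>_def by blast
  obtain q' where q': "q' \<in> S" "q' \<notin> set xs" "P' = spike \<pi> u v q'" "reflex_tip \<pi> u v q'"
    "det2 (u - q') (v - q') > 0" "inside P' \<inter> S = {}"
    using P' unfolding hole_code_def u_def v_def \<pi>_def by blast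
  have "q = q'"
  proof (rule ccontr)
    assume ne: "q \<noteq> q'"
    have uv: "u \<in> set xs" "v \<in> set xs" using \<open>xs \<noteq> []\<close> by (auto simp: u_def v_def)
    then have "\<not> collinear {q, q', v}" "\<not> collinear {q, u, q'}"
      using S xs(3) q(1,2) q'(1,2) ne unfolding general_position_def by (metis subsetD)+
    then show False
      using reflex_tip_unique[OF q(4) q'(4) q(5)] q q' by (auto simp: collinear_iff_det2)
  qed
  then show ?thesis using q(3) q'(3) by simp
qed

text \<open>The cardinality of an infinite set is 0, so the lower bound has to know that the set of
  holes is finite.\<close>

lemma finite_nonconvex_k_holes:
  assumes "finite S"
  shows "finite (nonconvex_k_holes k S)"
proof (rule finite_subset)
  show "nonconvex_k_holes k S \<subseteq> polygon_boundary ` {vs. set vs \<subseteq> S \<and> length vs = k}"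
    by (auto simp: nonconvex_k_holes_def k_holes_def k_gons_def)
  show "finite (polygon_boundary ` {vs. set vs \<subseteq> S \<and> length vs = k})"
    using finite_lists_length_eq[OF assms] by blast
qed

lemma card_nonconvex_k_holes_le:
  assumes "finite S" "general_position S" "k \<ge> 4"
  shows "card (nonconvex_k_holes k S) \<le> card {xs. length xs = k - 1 \<and> distinct xs \<and> set xs \<subseteq> S}"
proof -
  have "\<forall>P\<in>nonconvex_k_holes k S. \<exists>xs. hole_code S (k - 1) P xs"
    using hole_code_exists assms by blast
  then obtain f where f: "\<And>P. P \<in> nonconvex_k_holes k S \<Longrightarrow> hole_code S (k - 1) P (f P)"
    by metis
  have "inj_on f (nonconvex_k_holes k S)"
  proof (rule inj_onI)
    fix P P' assume "P \<in> nonconvex_k_holes k S" "P' \<in> nonconvex_k_holes k S" "f P = f P'"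
    then have "hole_code S (k - 1) P (f P)" "hole_code S (k - 1) P' (f P)" using f by metis+
    then show "P = P'"
      by (rule hole_code_unique[OF assms(2), rotated]) (use assms(3) in simp)
  qed
  moreover have "f ` nonconvex_k_holes k S \<subseteq> {xs. length xs = k - 1 \<and> distinct xs \<and> set xs \<subseteq> S}"
    using f by (auto simp: hole_code_def)
  moreover have "finite {xs. length xs = k - 1 \<and> distinct xs \<and> set xs \<subseteq> S}"
    using finite_lists_length_eq[OF assms(1), of "k - 1"] by (rule rev_finite_subset) auto
  ultimately show ?thesis by (rule card_inj_on_le)
qed

lemma card_nonconvex_k_holes_le_fact:
  assumes "finite S" "general_position S" "k \<ge> 4"
  shows "real (card (nonconvex_k_holes k S)) \<le> fact (card S) / fact (card S + 1 - k)"
proof (cases "k - 1 \<le> card S")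
  case True
  then have "card {xs. length xs = k - 1 \<and> distinct xs \<and> set xs \<subseteq> S} = \<Prod>{card S - (k - 1) + 1..card S}"
    using card_lists_distinct_length_eq[OF assms(1) True] by simp
  also have "\<dots> = fact (card S) div fact (card S - (k - 1))"
    by (simp add: fact_div_fact)
  also have "real \<dots> = fact (card S) / fact (card S - (k - 1))"
    by (simp add: real_of_nat_div fact_dvd)
  also have "card S - (k - 1) = card S + 1 - k" using assms(3) by simp
  finally show ?thesis
    using card_nonconvex_k_holes_le[OF assms] by linarith
next
  case False
  \<comment> \<open>Here truncated subtraction makes the denominator \<open>fact 0\<close>; the
    bound holds because there is no list, hence no hole.\<close>
  have "{xs. length xs = k - 1 \<and> distinct xs \<and> set xs \<subseteq> S} = {}"
  proof (intro equals0I)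
    fix xs assume "xs \<in> {xs. length xs = k - 1 \<and> distinct xs \<and> set xs \<subseteq> S}"
    then have "k - 1 \<le> card S"
      using card_mono[OF assms(1), of "set xs"] distinct_card[of xs] by auto
    then show False using False by blast
  qed
  then have "card (nonconvex_k_holes k S) = 0"
    using card_nonconvex_k_holes_le[OF assms] by (simp only: card.empty)
  then show ?thesis by simp
qed

lemma card_nonconvex_k_holes_le_power:
  assumes "finite S" "general_position S" "k \<ge> 4"
  shows "card (nonconvex_k_holes k S) \<le> card S ^ (k - 1)"
proof -
  have "card {xs. length xs = k - 1 \<and> distinct xs \<and> set xs \<subseteq> S} \<le> card {xs. set xs \<subseteq> S \<and> length xs = k - 1}"
    using finite_lists_length_eq[OF assms(1), of "k - 1"] by (intro card_mono) auto
  then show ?thesis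
    using card_nonconvex_k_holes_le[OF assms] card_lists_length_eq[OF assms(1), of "k - 1"] by simp
qed

section \<open>Holes on a parabola\<close>

text \<open>With at least three vertices an edge is determined by its ends; a cyclic list of two
  would have two edges on the same pair.\<close>

lemma edge_ends_eq:
  assumes "distinct vs" "length vs \<ge> 3" "i < length vs" "j < length vs"
    "edge_ends vs j \<subseteq> edge_ends vs i"
  shows "i = j"
proof -
  define k where "k = length vs"
  have "k > 0" using assms(3) unfolding k_def by linarith
  then have s: "Suc i mod k < k" "Suc j mod k < k" by simp_all
  have j: "j = i \<or> j = Suc i mod k"
    using assms s by (auto simp: edge_ends_def nth_eq_iff_index_eq k_def)
  have sj: "Suc j mod k = i \<or> Suc j mod k = Suc i mod k"
    using assms s by (auto simp: edge_ends_def nth_eq_iff_index_eq k_def)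
  show ?thesis
    using j sj assms(2-4) by (auto simp: mod_Suc k_def[symmetric] split: if_splits)
qed

text \<open>The line of edge \<open>i\<close> supports the vertex set and touches it in the two ends
  only. A common point is a zero of an affine function that is nonnegative at both ends of edge
  \<open>j\<close> and positive at one of them, so it is the other end.\<close>

lemma supported_edges_meet:
  assumes vs: "distinct vs" "length vs \<ge> 3" and ij: "i < length vs" "j < length vs" "i \<noteq> j"
    and nonneg: "\<And>p. p \<in> set vs \<Longrightarrow> Im p - \<alpha> * Re p + \<beta> \<ge> 0"
    and zero: "\<And>p. p \<in> set vs \<Longrightarrow> Im p - \<alpha> * Re p + \<beta> = 0 \<longleftrightarrow> p \<in> edge_ends vs i"
  shows "edge vs i \<inter> edge vs j = edge_ends vs i \<inter> edge_ends vs j"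
proof -
  define f where "f p = Im p - \<alpha> * Re p + \<beta>" for p
  have comb: "f ((1 - u) *\<^sub>R p + u *\<^sub>R p') = (1 - u) * f p + u * f p'" for u p p'
    by (simp add: f_def algebra_simps)
  define k where "k = length vs"
  have k: "k \<ge> 3" "i < k" "j < k" using vs ij by (auto simp: k_def)
  have mem: "edge_ends vs l \<subseteq> set vs" if "l < k" for l
  proof -
    have "Suc l mod k < k" using that by (intro mod_less_divisor) simp
    then show ?thesis using that by (simp add: edge_ends_def k_def)
  qed
  have edge: "edge vs l = closed_segment (vs ! l) (vs ! (Suc l mod k))" for l
    by (simp add: edge_def k_def)
  have ends: "edge_ends vs l = {vs ! l, vs ! (Suc l mod k)}" for l
    by (simp add: edge_ends_def k_def)
  have f0: "f p = 0 \<longleftrightarrow> p \<in> edge_ends vs i" if "p \<in> set vs" for p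
    using zero[OF that] by (simp add: f_def)
  have "z \<in> edge_ends vs i \<inter> edge_ends vs j" if z: "z \<in> edge vs i" "z \<in> edge vs j" for z
  proof -
    obtain u where u: "z = (1 - u) *\<^sub>R vs ! i + u *\<^sub>R vs ! (Suc i mod k)"
      using z(1) unfolding edge in_segment by auto
    have "f (vs ! i) = 0" "f (vs ! (Suc i mod k)) = 0" using f0 mem[OF k(2)] by (auto simp: ends)
    then have fz: "f z = 0" unfolding u comb by simp
    obtain w where w: "0 \<le> w" "w \<le> 1" "z = (1 - w) *\<^sub>R vs ! j + w *\<^sub>R vs ! (Suc j mod k)"
      using z(2) unfolding edge in_segment by auto
    define p where "p = vs ! j"
    define p' where "p' = vs ! (Suc j mod k)"
    have p: "p \<in> set vs" "p' \<in> set vs" "edge_ends vs j = {p, p'}"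
      using mem[OF k(3)] by (auto simp: ends p_def p'_def)
    have nn: "f p \<ge> 0" "f p' \<ge> 0" using nonneg p by (auto simp: f_def)
    have sum: "(1 - w) * f p + w * f p' = 0" using fz unfolding w(3) comb p_def p'_def .
    have "(1 - w) * f p \<ge> 0" "w * f p' \<ge> 0" using nn w by auto
    with sum have "(1 - w) * f p = 0" "w * f p' = 0" by linarith+
    moreover have "\<not> (f p = 0 \<and> f p' = 0)"
      using edge_ends_eq[OF vs ij(1,2)] ij(3) f0 p by auto
    ultimately have "w = 1 \<and> f p' = 0 \<or> w = 0 \<and> f p = 0" by auto
    then have "z = p' \<and> f p' = 0 \<or> z = p \<and> f p = 0" using w(3) by (auto simp: p_def p'_def)
    then show ?thesis using f0 p by auto
  qed
  moreover have "edge_ends vs l \<subseteq> edge vs l" for l by (auto simp: edge ends)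
  ultimately show ?thesis by blast
qed

definition para :: "real \<Rightarrow> complex" where
  "para t = Complex t (t\<^sup>2)"

definition apex :: complex where
  "apex = Complex 0 2"

lemma inj_para: "inj para"
  by (auto simp: inj_def para_def)

lemma apex_notin_para: "apex \<noteq> para t"
  by (simp add: apex_def para_def)

text \<open>The bounds separate the heights at which chords cross the axis: at most
  \<open>3 * (1/2)\<close> for a chord from left to middle, more than \<open>2 * 2\<close> for one
  from left to right, with the apex at height 2 in the gap.\<close>

definition left_part :: "real set" where "left_part = {-3..<-2}"
definition middle_part :: "real set" where "middle_part = {0<..1/2}"
definition right_part :: "real set" where "right_part = {2<..3}"

definition parameters :: "real set" where
  "parameters = left_part \<union> middle_part \<union> right_part"

text \<open>The chord through the parabola points at \<open>s\<close> and \<open>t\<close> crosses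
  the axis at height \<open>- s * t\<close>, so this says that the apex is on no chord.\<close>

lemma parameters_mult_neq:
  assumes "s \<in> parameters" "t \<in> parameters"
  shows "s * t + 2 \<noteq> 0"
proof -
  have pos: "x * y \<ge> 0" if "x \<ge> 0" "y \<ge> 0" for x y :: real using that by simp
  have lm: "x * y + 2 > 0" if "x \<in> left_part" "y \<in> middle_part" for x y
    using mult_mono[of "- x" 3 y "1/2"] that by (auto simp: left_part_def middle_part_def)
  have lr: "x * y + 2 < 0" if "x \<in> left_part" "y \<in> right_part" for x y
    using mult_strict_mono[of 2 "- x" 2 y] that by (auto simp: left_part_def right_part_def)
  have "s * t \<ge> 0 \<or> s \<in> left_part \<and> t \<in> middle_part \<or> t \<in> left_part \<and> s \<in> middle_part
    \<or> s \<in> left_part \<and> t \<in> right_part \<or> t \<in> left_part \<and> s \<in> right_part"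
    using assms pos[of s t] pos[of "- s" "- t"]
    by (auto simp: parameters_def left_part_def middle_part_def right_part_def)
  then show ?thesis using lm[of s t] lm[of t s] lr[of s t] lr[of t s] by (auto simp: mult.commute)
qed

text \<open>Both determinants factor: a Vandermonde product for three parabola points, and
  \<open>(t - s) * (s * t + 2)\<close> with the apex.\<close>

lemma general_position_parabola:
  assumes "X \<subseteq> parameters"
  shows "general_position (insert apex (para ` X))"
proof -
  have chord: "\<not> collinear {para r, para s, para t}" 
    if "para r \<noteq> para s" "para r \<noteq> para t" "para s \<noteq> para t" for r s t
  proof -
    have "det2 (para s - para r) (para t - para r) = (s - r) * (t - r) * (t - s)"
      by (simp add: det2_def para_def power2_eq_square algebra_simps)
    then show ?thesis using that by (auto simp: collinear_iff_det2)
  qed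
  have top: "\<not> collinear {apex, para s, para t}" if "s \<in> X" "t \<in> X" "para s \<noteq> para t" for s t
  proof -
    have "det2 (para s - apex) (para t - apex) = (t - s) * (s * t + 2)"
      by (simp add: det2_def para_def apex_def power2_eq_square algebra_simps)
    then show ?thesis
      using that parameters_mult_neq[of s t] assms by (auto simp: collinear_iff_det2)
  qed
  have top': "\<not> collinear {para s, apex, para t}" "\<not> collinear {para s, para t, apex}"
    if "s \<in> X" "t \<in> X" "para s \<noteq> para t" for s t
    using top[OF that] by (simp_all add: insert_commute)
  show ?thesis
    unfolding general_position_def
  proof (intro ballI impI, elim conjE)
    fix p q r
    assume "p \<in> insert apex (para ` X)" "q \<in> insert apex (para ` X)" "r \<in> insert apex (para ` X)"
      "p \<noteq> q" "p \<noteq> r" "q \<noteq> r"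
    then show "\<not> collinear {p, q, r}"
      by (elim insertE imageE) (simp_all add: chord top top')
  qed
qed

section \<open>Simplicity of the polygon through a chain of parabola points and the apex\<close>

locale parabola_chain =
  fixes ts :: "real list" and m :: nat
  assumes m: "m \<ge> 2" and len: "length ts = Suc m" and sorted: "sorted_wrt (<) ts"
    and left: "ts ! 0 \<in> left_part" and right: "ts ! m \<in> right_part"
    and middle: "\<And>i. 0 < i \<Longrightarrow> i < m \<Longrightarrow> ts ! i \<in> middle_part"
begin

definition vertices :: "complex list" where
  "vertices = map para ts @ [apex]"

definition hole :: "complex set" where
  "hole = polygon_boundary vertices"

lemma less: "i < j \<Longrightarrow> j \<le> m \<Longrightarrow> ts ! i < ts ! j"
  using sorted_wrt_nth_less[OF sorted] len by auto

lemma length_vertices: "length vertices = Suc (Suc m)"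
  by (simp add: vertices_def len)

lemma set_vertices: "set vertices = insert apex (para ` set ts)"
  by (simp add: vertices_def)

lemma distinct_vertices: "distinct vertices"
proof -
  have "distinct ts" using sorted by (simp add: strict_sorted_iff)
  then show ?thesis
    using apex_notin_para inj_para by (auto simp: vertices_def distinct_map inj_on_def inj_def)
qed

lemma edges:
  "i < m \<Longrightarrow> edge vertices i = closed_segment (para (ts ! i)) (para (ts ! Suc i))"
  "i < m \<Longrightarrow> edge_ends vertices i = {para (ts ! i), para (ts ! Suc i)}"
  "edge vertices m = closed_segment apex (para (ts ! m))"
  "edge_ends vertices m = {apex, para (ts ! m)}"
  "edge vertices (Suc m) = closed_segment apex (para (ts ! 0))"
  "edge_ends vertices (Suc m) = {apex, para (ts ! 0)}"
proof -
  have "ts \<noteq> []" using len by auto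
  then have "hd (map para ts) = para (ts ! 0)" "last (map para ts) = para (ts ! m)"
    using len by (simp_all add: hd_map last_map hd_conv_nth last_conv_nth)
  then show "i < m \<Longrightarrow> edge vertices i = closed_segment (para (ts ! i)) (para (ts ! Suc i))"
    "i < m \<Longrightarrow> edge_ends vertices i = {para (ts ! i), para (ts ! Suc i)}"
    "edge vertices m = closed_segment apex (para (ts ! m))"
    "edge_ends vertices m = {apex, para (ts ! m)}"
    "edge vertices (Suc m) = closed_segment apex (para (ts ! 0))"
    "edge_ends vertices (Suc m) = {apex, para (ts ! 0)}"
    using edge_snoc[of "map para ts", where q = apex] len m
    by (simp_all add: vertices_def)
qed

text \<open>Only the first chord crosses from negative to positive abscissae, and it ends in the
  middle part; for all others the product is positive.\<close>

lemma apex_above_chord: "i < m \<Longrightarrow> 2 + ts ! i * ts ! Suc i > 0"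
proof (cases "i = 0")
  case True
  have "ts ! 1 \<in> middle_part" using m by (intro middle) auto
  then show ?thesis
    using True left mult_mono[of "- (ts ! 0)" 3 "ts ! 1" "1/2"]
    by (auto simp: left_part_def middle_part_def)
next
  case False
  assume "i < m"
  then have "ts ! i > 0" using False middle by (auto simp: middle_part_def)
  moreover have "ts ! Suc i > ts ! i" using \<open>i < m\<close> by (intro less) auto
  ultimately have "ts ! i * ts ! Suc i > 0" by simp
  then show ?thesis by simp
qed

text \<open>On the parabola the equation of the chord becomes
  \<open>(t - ts ! i) * (t - ts ! Suc i)\<close>, which is negative only strictly between two
  consecutive parameters, where the chain has no vertex.\<close>

lemma chord_supports:
  assumes i: "i < m" and p: "p \<in> set vertices"
  defines "f \<equiv> Im p - (ts ! i + ts ! Suc i) * Re p + ts ! i * ts ! Suc i"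
  shows "f \<ge> 0" "f = 0 \<longleftrightarrow> p \<in> edge_ends vertices i"
proof -
  have "f \<ge> 0 \<and> (f = 0 \<longleftrightarrow> p \<in> edge_ends vertices i)"
  proof (cases "p = apex")
    case True
    then show ?thesis
      using apex_above_chord[OF i] i by (auto simp: f_def apex_def edges) (auto simp: para_def)
  next
    case False
    then obtain j where j: "j \<le> m" "p = para (ts ! j)"
      using p len by (auto simp: set_vertices in_set_conv_nth less_Suc_eq_le)
    have f: "f = (ts ! j - ts ! i) * (ts ! j - ts ! Suc i)"
      by (simp add: f_def j para_def power2_eq_square algebra_simps)
    have mem: "p \<in> edge_ends vertices i \<longleftrightarrow> ts ! j = ts ! i \<or> ts ! j = ts ! Suc i"
      using i inj_para by (auto simp: edges j inj_def)
    consider "j < i" | "j = i \<or> j = Suc i" | "Suc i < j" by linarith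
    then show ?thesis
    proof cases
      case 1
      then have "ts ! j < ts ! i" "ts ! i < ts ! Suc i" using i by (auto intro!: less)
      then show ?thesis unfolding f mem by (auto simp: mult_nonpos_nonpos)
    next
      case 2
      then show ?thesis unfolding f mem by auto
    next
      case 3
      then have "ts ! j > ts ! Suc i" "ts ! i < ts ! Suc i" using i j by (auto intro!: less)
      then show ?thesis unfolding f mem by auto
    qed
  qed
  then show "f \<ge> 0" "f = 0 \<longleftrightarrow> p \<in> edge_ends vertices i" by auto
qed

text \<open>These two edges leave the axis on opposite sides, so they share only the apex. Neither
  need support the vertex set, since the apex is a reflex vertex.\<close>

lemma apex_edges_meet:
  "edge vertices m \<inter> edge vertices (Suc m) = edge_ends vertices m \<inter> edge_ends vertices (Suc m)"
proof -
  have r: "ts ! m > 2" "ts ! 0 < -2" using left right by (auto simp: left_part_def right_part_def)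
  have "z = apex" if z: "z \<in> closed_segment apex (para (ts ! m))" "z \<in> closed_segment apex (para (ts ! 0))" for z
  proof -
    obtain u where u: "u \<ge> 0" "z = (1 - u) *\<^sub>R apex + u *\<^sub>R para (ts ! m)"
      using z(1) by (auto simp: in_segment)
    obtain w where w: "w \<ge> 0" "z = (1 - w) *\<^sub>R apex + w *\<^sub>R para (ts ! 0)"
      using z(2) by (auto simp: in_segment)
    have "Re z = u * ts ! m" by (simp add: u(2) apex_def para_def)
    moreover have "Re z = w * ts ! 0" by (simp add: w(2) apex_def para_def)
    moreover have "u * ts ! m \<ge> 0" "w * ts ! 0 \<le> 0"
      using u(1) w(1) r by (auto simp: mult_nonneg_nonpos)
    ultimately have "u * ts ! m = 0" by linarith
    then have "u = 0" using r by simp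
    then show ?thesis using u(2) by simp
  qed
  moreover have "para (ts ! m) \<noteq> para (ts ! 0)" using r by (auto simp: para_def)
  ultimately show ?thesis using apex_notin_para by (auto simp: edges)
qed

lemma simple_vertices: "simple_polygon vertices"
  unfolding simple_polygon_def
proof (intro conjI allI impI)
  show "3 \<le> length vertices" "distinct vertices"
    using m by (auto simp: length_vertices distinct_vertices)
  fix i j assume ij: "i < length vertices" "j < length vertices" "i \<noteq> j"
  have chain: "edge vertices i \<inter> edge vertices j = edge_ends vertices i \<inter> edge_ends vertices j"
    if "i < m" "j < length vertices" "i \<noteq> j" for i j
  proof (rule supported_edges_meet)
    show "distinct vertices" by (rule distinct_vertices)
    show "Im p - (ts ! i + ts ! Suc i) * Re p + ts ! i * ts ! Suc i \<ge> 0" if "p \<in> set vertices" for p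
      using chord_supports(1)[OF \<open>i < m\<close> that] .
    show "Im p - (ts ! i + ts ! Suc i) * Re p + ts ! i * ts ! Suc i = 0 \<longleftrightarrow> p \<in> edge_ends vertices i"
      if "p \<in> set vertices" for p
      using chord_supports(2)[OF \<open>i < m\<close> that] .
  qed (use that m in \<open>auto simp: length_vertices\<close>)
  have "i < m \<or> j < m \<or> i = m \<and> j = Suc m \<or> i = Suc m \<and> j = m"
    using ij unfolding length_vertices by linarith
  then consider "i < m" | "j < m" | "i = m" "j = Suc m" | "i = Suc m" "j = m"
    by blast
  then show "edge vertices i \<inter> edge vertices j = edge_ends vertices i \<inter> edge_ends vertices j"
  proof cases
    case 2
    then show ?thesis using chain[of j i] ij by (simp add: Int_commute)
  next
    case 4
    then show ?thesis using apex_edges_meet by (simp add: Int_commute)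
  qed (use chain ij apex_edges_meet in auto)
qed

end

section \<open>Emptiness and non-convexity of the polygon\<close>

definition epigraph :: "complex set" where
  "epigraph = {z. (Re z)\<^sup>2 \<le> Im z}"

lemma epigraph_combination:
  fixes u :: real and p p' :: complex
  defines "z \<equiv> (1 - u) *\<^sub>R p + u *\<^sub>R p'"
  shows "Im z - (Re z)\<^sup>2 = (1 - u) * (Im p - (Re p)\<^sup>2) + u * (Im p' - (Re p')\<^sup>2)
    + u * (1 - u) * (Re p - Re p')\<^sup>2"
  by (simp add: z_def power2_eq_square algebra_simps)

text \<open>Strict convexity of the square: the term
  \<open>u * (1 - u) * (Re p - Re p')\<^sup>2\<close> keeps a non-vertical segment off the parabola
  except at its ends.\<close>

lemma segment_in_epigraph:
  assumes "p \<in> epigraph" "p' \<in> epigraph" "z \<in> closed_segment p p'"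
  shows "z \<in> epigraph" and "Im z = (Re z)\<^sup>2 \<Longrightarrow> Re p \<noteq> Re p' \<Longrightarrow> z = p \<or> z = p'"
proof -
  obtain u where u: "0 \<le> u" "u \<le> 1" "z = (1 - u) *\<^sub>R p + u *\<^sub>R p'"
    using assms(3) by (auto simp: in_segment)
  have nn: "(1 - u) * (Im p - (Re p)\<^sup>2) \<ge> 0" "u * (Im p' - (Re p')\<^sup>2) \<ge> 0"
    "u * (1 - u) * (Re p - Re p')\<^sup>2 \<ge> 0"
    using assms u by (auto simp: epigraph_def)
  note comb = epigraph_combination[of u p p', folded u(3)]
  show "z \<in> epigraph" using nn comb by (simp add: epigraph_def)
  assume "Im z = (Re z)\<^sup>2" "Re p \<noteq> Re p'"
  then have "u * (1 - u) * (Re p - Re p')\<^sup>2 = 0" using nn comb by linarith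
  then have "u = 0 \<or> u = 1" using \<open>Re p \<noteq> Re p'\<close> by auto
  then show "z = p \<or> z = p'" using u(3) by auto
qed

lemma convex_epigraph: "convex epigraph"
  unfolding convex_contains_segment using segment_in_epigraph(1) by blast

lemma para_in_epigraph: "para t \<in> epigraph"
  by (simp add: para_def epigraph_def)

context parabola_chain
begin

lemma set_ts: "set ts \<subseteq> parameters"
proof
  fix t assume "t \<in> set ts"
  then obtain j where "j \<le> m" "t = ts ! j" using len by (auto simp: in_set_conv_nth less_Suc_eq_le)
  then show "t \<in> parameters"
    using left right middle[of j] by (cases "j = 0"; cases "j = m") (auto simp: parameters_def)
qed

lemma vertices_in_epigraph: "p \<in> set vertices \<Longrightarrow> p \<in> epigraph"
  using para_in_epigraph by (auto simp: set_vertices apex_def epigraph_def)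

lemma Re_vertices_inj:
  assumes "p \<in> set vertices" "p' \<in> set vertices" "Re p = Re p'"
  shows "p = p'"
proof -
  have "t \<noteq> 0" if "t \<in> set ts" for t
    using set_ts that by (auto simp: parameters_def left_part_def middle_part_def right_part_def)
  then show ?thesis using assms by (auto simp: set_vertices para_def apex_def)
qed

lemma hole_edge:
  assumes "z \<in> hole"
  obtains i where "i < m" "z \<in> closed_segment (para (ts ! i)) (para (ts ! Suc i))"
  | j where "j = 0 \<or> j = m" "z \<in> closed_segment apex (para (ts ! j))"
proof -
  obtain i where i: "i < length vertices" "z \<in> edge vertices i"
    using assms by (auto simp: hole_def polygon_boundary_def)
  then have "i < m \<or> i = m \<or> i = Suc m" unfolding length_vertices by linarith
  then show thesis
  proof (elim disjE)
    assume "i < m"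
    then show thesis using i(2) edges(1) that(1) by simp
  next
    assume "i = m"
    then show thesis using i(2) edges(3) that(2)[of m] by simp
  next
    assume "i = Suc m"
    then show thesis using i(2) edges(5) that(2)[of 0] by simp
  qed
qed

lemma hole_segment:
  assumes "z \<in> hole"
  obtains p p' where "p \<in> set vertices" "p' \<in> set vertices" "p \<noteq> p'" "z \<in> closed_segment p p'"
proof -
  have v: "para (ts ! j) \<in> set vertices" "apex \<in> set vertices" if "j \<le> m" for j
    using that len by (auto simp: set_vertices)
  from assms show thesis
  proof (cases rule: hole_edge)
    case (1 i)
    then have "para (ts ! i) \<noteq> para (ts ! Suc i)"
      using less[of i "Suc i"] by (simp add: inj_eq[OF inj_para])
    then show thesis using 1 v by (intro that) auto
  next
    case (2 j)
    then show thesis using v apex_notin_para by (intro that) auto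
  qed
qed

lemma hole_subset_epigraph: "hole \<subseteq> epigraph"
proof
  fix z assume "z \<in> hole"
  then show "z \<in> epigraph"
    by (rule hole_segment) (use segment_in_epigraph(1) vertices_in_epigraph in blast)
qed

text \<open>The boundary curve alone reveals which abscissae were chosen; this makes the count of
  holes injective.\<close>

lemma hole_Int_parabola: "hole \<inter> range para = para ` set ts"
proof (intro equalityI subsetI)
  fix z assume z: "z \<in> hole \<inter> range para"
  then obtain p p' where p: "p \<in> set vertices" "p' \<in> set vertices" "p \<noteq> p'" "z \<in> closed_segment p p'"
    using hole_segment by blast
  have "Im z = (Re z)\<^sup>2" using z by (auto simp: para_def)
  then have "z = p \<or> z = p'"
    using p vertices_in_epigraph Re_vertices_inj by (intro segment_in_epigraph(2)) auto
  moreover have "z \<noteq> apex" using z apex_notin_para by (metis IntD2 rangeE)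
  ultimately show "z \<in> para ` set ts" using p(1,2) by (auto simp: set_vertices)
next
  fix z assume "z \<in> para ` set ts"
  then obtain t where t: "t \<in> set ts" "z = para t" by blast
  then obtain j where j: "j \<le> m" "t = ts ! j" using len by (auto simp: in_set_conv_nth less_Suc_eq_le)
  have "z \<in> edge vertices j"
    using edges(1)[of j] edges(3) j t by (cases "j < m") auto
  then have "z \<in> hole" using j by (auto simp: hole_def polygon_boundary_def length_vertices)
  then show "z \<in> hole \<inter> range para" using t by blast
qed

lemma apex_in_hole: "apex \<in> hole"
  using edges(3) by (auto simp: hole_def polygon_boundary_def length_vertices)

text \<open>The interior is open and contained in the epigraph, whereas points just below a parabola
  point leave the epigraph.\<close>

lemma inside_hole_empty: "inside hole \<inter> insert apex (range para) = {}"
proof -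
  have "para t \<notin> inside hole" for t
  proof
    assume "para t \<in> inside hole"
    moreover have "open (inside hole)" unfolding hole_def by (rule polygon_Jordan[OF simple_vertices])
    ultimately obtain e where e: "e > 0" "ball (para t) e \<subseteq> inside hole" using openE by blast
    have "para t - Complex 0 (e / 2) \<in> ball (para t) e"
      using e(1) by (simp add: dist_norm complex_norm)
    then have "para t - Complex 0 (e / 2) \<in> epigraph"
      using e(2) inside_subset_convex[OF convex_epigraph hole_subset_epigraph] by blast
    then show False using e(1) by (simp add: epigraph_def para_def)
  qed
  moreover have "apex \<notin> inside hole" using apex_in_hole inside_no_overlap[of hole] by blast
  ultimately show ?thesis by auto
qed

text \<open>Chords cross the axis below the apex, and the two edges at the apex meet the axis
  nowhere else. Hence the vertical ray above the apex misses the polygon.\<close>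

lemma hole_below_apex:
  assumes z: "z \<in> hole" "Re z = 0"
  shows "Im z \<le> 2"
  using z(1)
proof (cases rule: hole_edge)
  case (1 i)
  then obtain u where u: "0 \<le> u" "u \<le> 1"
    "z = (1 - u) *\<^sub>R para (ts ! i) + u *\<^sub>R para (ts ! Suc i)" by (auto simp: in_segment)
  define f where "f p = Im p - (ts ! i + ts ! Suc i) * Re p + ts ! i * ts ! Suc i" for p
  have "f z = (1 - u) * f (para (ts ! i)) + u * f (para (ts ! Suc i))"
    unfolding u(3) f_def by (simp add: algebra_simps)
  moreover have "f (para (ts ! i)) = 0" "f (para (ts ! Suc i)) = 0"
    by (simp_all add: f_def para_def power2_eq_square algebra_simps)
  ultimately have "f z = 0" by simp
  then show ?thesis using apex_above_chord[OF 1(1)] z(2) by (simp add: f_def)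
next
  case (2 j)
  then obtain u where u: "z = (1 - u) *\<^sub>R apex + u *\<^sub>R para (ts ! j)" by (auto simp: in_segment)
  have "ts ! j \<noteq> 0" using 2(1) left right by (auto simp: left_part_def right_part_def)
  moreover have "u * ts ! j = 0" using z(2) by (simp add: u apex_def para_def)
  ultimately have "u = 0" by simp
  then show ?thesis by (simp add: u apex_def)
qed

text \<open>The segment from the leftmost to the rightmost vertex crosses the axis above the apex,
  on a ray that runs to infinity without meeting the polygon and so lies outside.\<close>

lemma not_convex_hole: "\<not> convex_polygon hole"
proof
  assume "convex_polygon hole"
  then have conv: "convex (hole \<union> inside hole)" by (simp add: convex_polygon_def)
  define a where "a = ts ! 0"
  define c where "c = ts ! m"
  have ac: "a < -2" "c > 2" using left right by (auto simp: a_def c_def left_part_def right_part_def)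
  have "a \<in> set ts" "c \<in> set ts" using len by (auto simp: a_def c_def)
  then have "para a \<in> hole" "para c \<in> hole" using hole_Int_parabola by blast+
  then have sub: "closed_segment (para a) (para c) \<subseteq> hole \<union> inside hole"
    using conv by (simp add: convex_contains_segment)
  \<comment> \<open>The parameter at which the segment crosses the axis; the height there is
    \<open>- a * c\<close>.\<close>
  define u where "u = - a / (c - a)"
  define z where "z = (1 - u) *\<^sub>R para a + u *\<^sub>R para c"
  have "0 \<le> u" unfolding u_def using ac by (intro divide_nonneg_pos) auto
  moreover have "u \<le> 1" unfolding u_def using ac by (subst pos_divide_le_eq) auto
  ultimately have u: "0 \<le> u" "u \<le> 1" .
  have u': "u * (c - a) = - a" using ac by (simp add: u_def)
  have "z \<in> closed_segment (para a) (para c)"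
    unfolding in_segment z_def using u by blast
  then have zin: "z \<in> hole \<union> inside hole" using sub by blast
  have Rez: "Re z = 0" using u' by (simp add: z_def para_def algebra_simps)
  have "Im z = a\<^sup>2 + (u * (c - a)) * (c + a)"
    by (simp add: z_def para_def power2_eq_square algebra_simps)
  also have "\<dots> = (- a) * c" unfolding u' by (simp add: power2_eq_square algebra_simps)
  finally have Imz: "Im z > 2" using mult_strict_mono[of 2 "- a" 2 c] ac by simp
  define ray where "ray = {w. Re w = 0 \<and> Im w > 2}"
  have disj: "ray \<inter> hole = {}" using hole_below_apex by (force simp: ray_def)
  have "ray = {w. Re w = 0} \<inter> {w. Im w > 2}" by (auto simp: ray_def)
  moreover have "convex {w. Re w = 0}" by (simp add: convex_def)
  ultimately have "connected ray"
    by (metis convex_halfspace_Im_gt convex_Int convex_connected)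
  moreover have "\<not> bounded ray"
  proof
    assume "bounded ray"
    then obtain b where b: "\<And>w. w \<in> ray \<Longrightarrow> norm w \<le> b" by (auto simp: bounded_iff)
    have "norm (Complex 0 (\<bar>b\<bar> + 3)) \<le> b" by (intro b) (auto simp: ray_def)
    then show False by (simp add: complex_norm)
  qed
  moreover have "(- hole - ray) \<union> ray = - hole" using disj by blast
  ultimately have "inside hole \<subseteq> - hole - ray" by (rule inside_subset)
  moreover have "z \<in> ray" using Rez Imz by (simp add: ray_def)
  ultimately show False using zin disj by blast
qed

lemma hole_in_nonconvex_k_holes:
  assumes "set ts \<subseteq> X"
  shows "hole \<in> nonconvex_k_holes (m + 2) (insert apex (para ` X))"
proof -
  have "set vertices \<subseteq> insert apex (para ` X)" using assms by (auto simp: set_vertices)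
  then have "hole \<in> k_gons (m + 2) (insert apex (para ` X))"
    unfolding k_gons_def hole_def using simple_vertices length_vertices by auto
  moreover have "inside hole \<inter> insert apex (para ` X) = {}" using inside_hole_empty by blast
  ultimately show ?thesis
    using not_convex_hole by (simp add: nonconvex_k_holes_def k_holes_def)
qed

end

section \<open>Counting the holes of one point set\<close>

lemma parabola_chainI:
  assumes "a \<in> left_part" "c \<in> right_part" "M \<subseteq> middle_part" "finite M" "card M > 0"
  defines "ts \<equiv> a # sorted_list_of_set M @ [c]"
  shows "parabola_chain ts (Suc (card M))"
proof
  have l: "length (sorted_list_of_set M) = card M" "set (sorted_list_of_set M) = M"
    using assms by auto
  show "Suc (card M) \<ge> 2" using assms by simp
  show "length ts = Suc (Suc (card M))" by (simp add: ts_def l)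
  show "sorted_wrt (<) ts"
    using assms by (auto simp: ts_def sorted_wrt_append left_part_def middle_part_def right_part_def)
  show "ts ! 0 \<in> left_part" using assms by (simp add: ts_def)
  show "ts ! Suc (card M) \<in> right_part" using assms by (simp add: ts_def nth_append l)
  fix i assume i: "0 < i" "i < Suc (card M)"
  then have "ts ! i = sorted_list_of_set M ! (i - 1)"
    by (cases i) (auto simp: ts_def nth_append l)
  moreover have "sorted_list_of_set M ! (i - 1) \<in> M" 
    using nth_mem[of "i - 1" "sorted_list_of_set M"] i l by simp
  ultimately show "ts ! i \<in> middle_part" using assms by auto
qed

text \<open>Apex, left and right point leave \<open>k - 3\<close> vertices for the middle. Sorting
  fixes their order, so a set \<open>M\<close> is chosen, and the three disjoint parts recover the
  whole triple from the abscissae of a hole.\<close>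

lemma card_nonconvex_k_holes_ge:
  assumes X: "finite X" and k: "k \<ge> 4"
  shows "card (X \<inter> left_part) * (card (X \<inter> middle_part) choose (k - 3)) * card (X \<inter> right_part)
    \<le> card (nonconvex_k_holes k (insert apex (para ` X)))"
proof -
  define Ms where "Ms = {M. M \<subseteq> X \<inter> middle_part \<and> card M = k - 3}"
  define D where "D = (X \<inter> left_part) \<times> Ms \<times> (X \<inter> right_part)"
  define ts where "ts = (\<lambda>(a :: real, M, c). a # sorted_list_of_set M @ [c])"
  define hole where "hole x = parabola_chain.hole (ts x)" for x
  have D: "parabola_chain (ts x) (k - 2)" "set (ts x) = insert (fst x) (insert (snd (snd x)) (fst (snd x)))"
    "set (ts x) \<subseteq> X" if "x \<in> D" for x
  proof -
    obtain a M c where x: "x = (a, M, c)" by (cases x)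
    have M: "finite M" "M \<subseteq> X \<inter> middle_part" "card M = k - 3"
      using that X finite_subset[of M X] by (auto simp: D_def Ms_def x)
    then show "parabola_chain (ts x) (k - 2)"
      using parabola_chainI[of a c M] that k by (simp add: D_def x ts_def numeral_eq_Suc Suc_diff_Suc)
    show "set (ts x) = insert (fst x) (insert (snd (snd x)) (fst (snd x)))"
      using M(1) by (auto simp: ts_def x)
    then show "set (ts x) \<subseteq> X" using that M(2) by (auto simp: D_def x)
  qed
  have "card D \<le> card (nonconvex_k_holes k (insert apex (para ` X)))"
  proof (rule card_inj_on_le)
    show "hole ` D \<subseteq> nonconvex_k_holes k (insert apex (para ` X))"
    proof clarify
      fix a M c assume x: "(a, M, c) \<in> D"
      have "k - 2 + 2 = k" using k by simp
      then show "hole (a, M, c) \<in> nonconvex_k_holes k (insert apex (para ` X))"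
        using parabola_chain.hole_in_nonconvex_k_holes[OF D(1)[OF x] D(3)[OF x]] by (simp add: hole_def)
    qed
    show "finite (nonconvex_k_holes k (insert apex (para ` X)))"
      using X by (intro finite_nonconvex_k_holes) simp
    show "inj_on hole D"
    proof (rule inj_onI)
      fix x y assume xy: "x \<in> D" "y \<in> D" "hole x = hole y"
      then have "para ` set (ts x) = para ` set (ts y)"
        using parabola_chain.hole_Int_parabola D(1) unfolding hole_def by metis
      then have "set (ts x) = set (ts y)" using inj_para by (simp add: inj_image_eq_iff)
      moreover have "set (ts z) \<inter> left_part = {fst z}" "set (ts z) \<inter> right_part = {snd (snd z)}"
        "set (ts z) \<inter> middle_part = fst (snd z)" if "z \<in> D" for z
        using that unfolding D(2)[OF that]
        by (auto simp: D_def Ms_def left_part_def middle_part_def right_part_def)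
      ultimately show "x = y" using xy(1,2) by (metis prod.collapse singleton_inject)
    qed
  qed
  moreover have "card Ms = card (X \<inter> middle_part) choose (k - 3)"
    unfolding Ms_def using X by (intro n_subsets) simp
  ultimately show ?thesis by (simp add: D_def card_cartesian_product mult.assoc)
qed

section \<open>Point sets of every size\<close>

definition parameter :: "nat \<Rightarrow> real" where
  "parameter i =
     (if i mod 3 = 0 then - 2 - 1 / real (Suc (i div 3))
      else if i mod 3 = 1 then 1 / real (Suc (Suc (i div 3)))
      else 2 + 1 / real (Suc (i div 3)))"

lemma parameter_values:
  "parameter (3 * j) = - 2 - 1 / real (Suc j)"
  "parameter (3 * j + 1) = 1 / real (Suc (Suc j))"
  "parameter (3 * j + 2) = 2 + 1 / real (Suc j)"
proof -
  have "(3 * j) div 3 = j" "(3 * j) mod 3 = 0" "(3 * j + 1) div 3 = j" "(3 * j + 1) mod 3 = 1"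
    "(3 * j + 2) div 3 = j" "(3 * j + 2) mod 3 = 2" by presburger+
  then show "parameter (3 * j) = - 2 - 1 / real (Suc j)"
    "parameter (3 * j + 1) = 1 / real (Suc (Suc j))"
    "parameter (3 * j + 2) = 2 + 1 / real (Suc j)"
    by (simp_all only: parameter_def) simp_all
qed

text \<open>Reciprocals supply infinitely many distinct values in bounded intervals; the middle
  class starts with the denominator 2, because its upper bound is \<open>1/2\<close>.\<close>

lemma parameter_part:
  "parameter (3 * j) \<in> left_part" "parameter (3 * j + 1) \<in> middle_part"
  "parameter (3 * j + 2) \<in> right_part"
  unfolding parameter_values left_part_def middle_part_def right_part_def
  by (simp_all add: field_simps)

lemma mod_3_cases:
  obtains j where "i = 3 * j" | j where "i = 3 * j + 1" | j where "i = 3 * j + (2 :: nat)"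
proof -
  have "i = 3 * (i div 3) \<or> i = 3 * (i div 3) + 1 \<or> i = 3 * (i div 3) + 2" by presburger
  then show thesis using that by blast
qed

lemma parameter_in_parameters: "parameter i \<in> parameters"
proof (cases i rule: mod_3_cases)
  case (1 j)
  then show ?thesis using parameter_part(1)[of j] by (simp add: parameters_def)
next
  case (2 j)
  then show ?thesis using parameter_part(2)[of j] by (simp add: parameters_def)
next
  case (3 j)
  then show ?thesis using parameter_part(3)[of j] by (simp add: parameters_def)
qed

lemma inj_parameter: "inj parameter"
proof (rule injI)
  fix i j assume eq: "parameter i = parameter j"
  have disj: "x \<in> left_part \<Longrightarrow> x \<notin> middle_part" "x \<in> left_part \<Longrightarrow> x \<notin> right_part"
    "x \<in> middle_part \<Longrightarrow> x \<notin> right_part" for x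
    by (auto simp: left_part_def middle_part_def right_part_def)
  show "i = j"
  proof (cases i rule: mod_3_cases)
    case i: (1 a)
    then have "parameter j \<in> left_part" using eq parameter_part(1)[of a] by simp
    then obtain b where "j = 3 * b"
      using disj parameter_part(2,3) by (cases j rule: mod_3_cases) blast+
    then show ?thesis using eq i by (simp add: parameter_values)
  next
    case i: (2 a)
    then have "parameter j \<in> middle_part" using eq parameter_part(2)[of a] by simp
    then obtain b where "j = 3 * b + 1"
      using disj parameter_part(1,3) by (cases j rule: mod_3_cases) blast+
    then show ?thesis using eq i by (simp only: parameter_values) simp
  next
    case i: (3 a)
    then have "parameter j \<in> right_part" using eq parameter_part(3)[of a] by simp
    then obtain b where "j = 3 * b + 2"
      using disj parameter_part(1,2) by (cases j rule: mod_3_cases) blast+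
    then show ?thesis using eq i by (simp only: parameter_values) simp
  qed
qed

text \<open>The residues of the index modulo 3 deal the abscissae out to the three parts in turn, so
  every initial segment is balanced.\<close>

lemma parameter_counts:
  defines "X n \<equiv> parameter ` {..<n}"
  shows "n div 3 \<le> card (X n \<inter> left_part)" "n div 3 \<le> card (X n \<inter> middle_part)"
    "n div 3 \<le> card (X n \<inter> right_part)"
proof -
  have *: "n div 3 \<le> card (X n \<inter> A)" if A: "\<And>j. parameter (3 * j + d) \<in> A" and d: "d < 3" for A d
  proof -
    have "(\<lambda>j. parameter (3 * j + d)) ` {..<n div 3} \<subseteq> X n \<inter> A"
      using A d by (auto simp: X_def)
    moreover have "inj_on (\<lambda>j. parameter (3 * j + d)) {..<n div 3}"
      by (intro inj_onI) (simp add: inj_eq[OF inj_parameter])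
    moreover have "finite (X n \<inter> A)" by (simp add: X_def)
    ultimately show ?thesis using card_inj_on_le by (metis card_lessThan)
  qed
  show "n div 3 \<le> card (X n \<inter> left_part)" using *[of 0 left_part] parameter_part(1) by simp
  show "n div 3 \<le> card (X n \<inter> middle_part)" using *[of 1 middle_part] parameter_part(2) by simp
  show "n div 3 \<le> card (X n \<inter> right_part)" using *[of 2 right_part] parameter_part(3) by simp
qed

definition point_set :: "nat \<Rightarrow> complex set" where
  "point_set n = (if n = 0 then {} else insert apex (para ` parameter ` {..<n - 1}))"

lemma point_set: "finite (point_set n)" "card (point_set n) = n" "general_position (point_set n)"
proof -
  have "card (para ` parameter ` {..<n - 1}) = n - 1"
    using inj_para inj_parameter by (simp add: card_image inj_on_subset)
  moreover have "apex \<notin> para ` parameter ` {..<n - 1}" using apex_notin_para by blast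
  ultimately show "finite (point_set n)" "card (point_set n) = n"
    by (auto simp: point_set_def)
  have "parameter ` {..<n - 1} \<subseteq> parameters" using parameter_in_parameters by blast
  then show "general_position (point_set n)"
    using general_position_parabola by (auto simp: point_set_def general_position_def[of "{}"])
qed

text \<open>Each part holds at least \<open>N\<close> parameters, and
  \<open>n \<le> 3 * N + 3\<close> gives \<open>N \<ge> n / 6\<close> once \<open>n \<ge> 6\<close>.
  Estimating the binomial coefficient by \<open>(N / (k - 3)) ^ (k - 3)\<close> costs a further
  factor \<open>k\<close> in each of its terms; the same factor is conceded to the left and right
  choices to obtain one power.\<close>

lemma card_nonconvex_k_holes_point_set:
  assumes k: "k \<ge> 4" and n: "n \<ge> 6 * k"
  shows "(real n / (6 * real k)) ^ (k - 1) \<le> real (card (nonconvex_k_holes k (point_set n)))"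
proof -
  define N where "N = (n - 1) div 3"
  define X where "X = parameter ` {..<n - 1}"
  have "n \<le> 3 * N + 3" unfolding N_def by presburger
  then have N: "real n / 6 \<le> real N" "k \<le> N" using n k by linarith+
  have le1: "real n / (6 * real k) \<le> real N"
  proof -
    have "real n / (6 * real k) \<le> real n / 6" using k by (intro divide_left_mono) auto
    then show ?thesis using N by linarith
  qed
  have "real n / (6 * real k) = real n / 6 / real k" by simp
  also have "\<dots> \<le> real N / real k" using N by (intro divide_right_mono) auto
  also have "\<dots> \<le> real N / real (k - 3)" using k by (intro divide_left_mono) auto
  finally have "(real n / (6 * real k)) ^ (k - 3) \<le> (real N / real (k - 3)) ^ (k - 3)"
    by (intro power_mono) auto
  \<comment> \<open>This estimate needs \<open>k - 3 \<le> N\<close>, which is why \<open>n\<close>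
    is taken to be at least \<open>6 * k\<close>.\<close>
  also have "\<dots> \<le> real (N choose (k - 3))"
    using N by (intro binomial_ge_n_over_k_pow_k) simp
  finally have mid: "(real n / (6 * real k)) ^ (k - 3) \<le> real (N choose (k - 3))" .
  have "k - 1 = 1 + (k - 3) + 1" using k by simp
  then have "(real n / (6 * real k)) ^ (k - 1) =
      real n / (6 * real k) * (real n / (6 * real k)) ^ (k - 3) * (real n / (6 * real k))"
    by (simp only: power_add power_one_right)
  also have "\<dots> \<le> real N * real (N choose (k - 3)) * real N"
    using le1 mid by (intro mult_mono) auto
  also have "\<dots> = real (N * (N choose (k - 3)) * N)" by simp
  also have "N * (N choose (k - 3)) * N \<le>
      card (X \<inter> left_part) * (card (X \<inter> middle_part) choose (k - 3)) * card (X \<inter> right_part)"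
    using parameter_counts[of "n - 1"] unfolding N_def X_def
    by (intro mult_le_mono binomial_right_mono) auto
  also have "\<dots> \<le> card (nonconvex_k_holes k (insert apex (para ` X)))"
    using k by (intro card_nonconvex_k_holes_ge) (auto simp: X_def)
  also have "insert apex (para ` X) = point_set n" using n k by (auto simp: point_set_def X_def)
  finally show ?thesis by simp
qed

theorem theorem3:
  fixes k :: nat
  assumes "k \<ge> 4"
  shows
    "(\<exists>C>0. \<forall>n S. finite S \<and> card S = n \<and> general_position S \<longrightarrow>
        real (card (nonconvex_k_holes k S)) \<le> C * real n ^ (k - 1)) \<and>
     (\<forall>n S. finite S \<and> card S = n \<and> general_position S \<longrightarrow>
        real (card (nonconvex_k_holes k S)) \<le> fact n / fact (n + 1 - k)) \<and>
     (\<exists>S :: nat \<Rightarrow> complex set.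
        (\<forall>n. finite (S n) \<and> card (S n) = n \<and> general_position (S n)) \<and>
        (\<lambda>n. real (card (nonconvex_k_holes k (S n)))) \<in> \<Omega>(\<lambda>n. real n ^ (k - 1)))"
proof (intro conjI)
  have "real (card (nonconvex_k_holes k S)) \<le> 1 * real (card S) ^ (k - 1)"
    if "finite S" "general_position S" for S
    using card_nonconvex_k_holes_le_power[OF that assms] by (simp flip: of_nat_power)
  then show "\<exists>C>0. \<forall>n S. finite S \<and> card S = n \<and> general_position S \<longrightarrow>
      real (card (nonconvex_k_holes k S)) \<le> C * real n ^ (k - 1)"
    by (intro exI[of _ 1]) auto
  show "\<forall>n S. finite S \<and> card S = n \<and> general_position S \<longrightarrow>
      real (card (nonconvex_k_holes k S)) \<le> fact n / fact (n + 1 - k)"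
    using card_nonconvex_k_holes_le_fact[OF _ _ assms] by blast
  have "(\<lambda>n. real (card (nonconvex_k_holes k (point_set n)))) \<in> \<Omega>(\<lambda>n. real n ^ (k - 1))"
  proof (rule landau_omega.bigI)
    show "(1 / (6 * real k)) ^ (k - 1) > 0" using assms by simp
    show "\<forall>\<^sub>F n in sequentially. norm (real (card (nonconvex_k_holes k (point_set n))))
        \<ge> (1 / (6 * real k)) ^ (k - 1) * norm (real n ^ (k - 1))"
      using eventually_ge_at_top[of "6 * k"]
    proof eventually_elim
      case (elim n)
      then show ?case
        using card_nonconvex_k_holes_point_set[OF assms elim] by (simp add: power_divide)
    qed
  qed
  then show "\<exists>S. (\<forall>n. finite (S n) \<and> card (S n) = n \<and> general_position (S n)) \<and>
      (\<lambda>n. real (card (nonconvex_k_holes k (S n)))) \<in> \<Omega>(\<lambda>n. real n ^ (k - 1))"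
    using point_set by blast
qed

end
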